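(* Let $\ell\in\mathbb{N}^+$, let $2\le\mu=\eta\in\mathbb{N}^+$, and let $\mathscr B$ be a Banach function space with the algebra property. Assume that $\rho_1,\dots,\rho_\ell\in\mathbb{T}^\infty$ satisfy the infinite-dimensional joint Diophantine condition with exponent $\mu=\eta$ (discrete version for the discrete average, continuous version for the continuous average), and that $F_j\in\mathscr{B}_{\tilde\Delta_\infty}$ with $\tilde\Delta_\infty(x)=\exp(\exp x)$ for all $1\le j\le\ell$. Then there is some $\zeta_2>0$ such that, for $N\in\mathbb N^+$ and $T>0$ sufficiently large, $$\Big\|\mathrm{DMW}_N^\ell(\mathcal F)(\theta)-\prod_{j=1}^\ell\Big(\int_{\mathbb{T}^\infty}F_j(\hat\theta)\,d\hat\theta\Big)\Big\|_{\mathscr B}=\mathcal{O}\big(\exp(-N^{\zeta_2})\big)$$ and $$\Big\|\mathrm{CMW}_T^\ell(\mathcal F)(\theta)-\prod_{j=1}^\ell\Big(\int_{\mathbb{T}^\infty}F_j(\hat\theta)\,d\hat\theta\Big)\Big\|_{\mathscr B}=\mathcal{O}\big(\exp(-T^{\zeta_2})\big).$$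
   Context: Weight: $w(x)=\exp(-x^{-1}(1-x)^{-1})\big(\int_0^1\exp(-t^{-1}(1-t)^{-1})dt\big)^{-1}$ for $x\in(0,1)$ and $w(x)=0$ otherwise. Torus and rotations: $\mathbb{T}^\infty=\mathbb{T}^{\mathbb N}$ (with $0\in\mathbb N$), with the product probability measure; rotation vectors are taken in the cube $[1,2]^{\mathbb N}$, identified with $\mathbb{T}^\infty$. For $s\ge0$, $\mathscr{T}_\rho^s(\theta)=\theta+s\rho\bmod 1$ in each coordinate. Averages: with $A_N=\sum_{s=0}^{N-1}w(s/N)$, $$\mathrm{DMW}_N^\ell(\mathcal F)(\theta)=\frac1{A_N}\sum_{n=0}^{N-1}w(n/N)F_1(\mathscr{T}_{\rho_1}^n(\theta))\cdots F_\ell(\mathscr{T}_{\rho_\ell}^n(\theta)),$$ $$\mathrm{CMW}_T^\ell(\mathcal F)(\theta)=\frac1T\int_0^T w(s/T)F_1(\mathscr{T}_{\rho_1}^s(\theta))\cdots F_\ell(\mathscr{T}_{\rho_\ell}^s(\theta))\,ds .$$ For $j\in\mathbb N$, $\langle j\rangle=\max\{1,|j|\}$; $\mathbb{Z}_*^\infty=\{k\in\mathbb{Z}^{\mathbb N}:|k|_\eta:=\sum_{j\in\mathbb N}\langle j\rangle^\eta|k_j|<+\infty\}$; $k\cdot\theta=\sum_j k_j\theta_j$. Infinite-dimensional joint Diophantine condition with exponent $\mu$: for joint integer vectors $k=(k^1,\dots,k^\ell)$ with $k^i=(k^i_j)_{j\in\mathbb N}\in\mathbb{Z}_*^\infty$,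 and $\tilde\rho=(\rho_1,\dots,\rho_\ell)$, put $k\cdot\tilde\rho=\sum_{i}k^i\cdot\rho_i$. There is $\gamma>0$ such that, for all joint integer vectors $k\neq0$: in the discrete case, $$|k\cdot\tilde\rho-n|>\gamma\prod_{i=1}^{\ell}\prod_{j\in\mathbb N}\big(1+|k^i_j|^\mu\langle j\rangle^\mu\big)^{-1}\quad\text{for all } n\in\mathbb{Z};$$ in the continuous case, the same inequality with $n=0$ only. $(\mathscr B,\|\cdot\|_{\mathscr B})$ is a Banach (function) space with the algebra property (products of elements are in $\mathscr B$, with bounded multiplication). $\mathscr{B}_{\tilde\Delta_\infty}$ is the set of $f:\mathbb{T}^\infty\to\mathscr B$ with $f(\theta)=\sum_{k\in\mathbb{Z}_*^\infty}\hat f_k e^{2\pi i k\cdot\theta}$ (equality in the norm of $\mathscr B$), $\hat f_k=\int_{\mathbb{T}^\infty}f(\hat\theta)e^{-2\pi i k\cdot\hat\theta}d\hat\theta$, and $\sup_{0\ne k\in\mathbb{Z}_*^\infty}\tilde\Delta_\infty(|k|_\eta)\|\hat f_k\|_{\mathscr B}<+\infty$. Products of such functions are taken through multiplication in $\mathscr B$. $\mathcal{O}(\cdot)$ means bounded by a constant, independent of $N$ (resp. $T$), times the argument for all sufficiently large $N$ (resp. $T$). *)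

theory Defs
  imports "HOL-Analysis.Analysis"
begin

section \<open>Complex Banach spaces with the algebra property\<close>

text \<open>The library has no class of complex Banach spaces (complex scalars are needed because
  Fourier coefficients are complex combinations of values).  Multiplication is only required to be
  bounded, not submultiplicative, and no unit and no commutativity are required; algebras of
  functions under pointwise multiplication are a special case.\<close>

class complex_banach_algebra = banach + real_algebra +
  fixes scaleC :: "complex \<Rightarrow> 'a \<Rightarrow> 'a"  (infixr "*\<^sub>C" 75)
  assumes scaleC_add_right: "a *\<^sub>C (x + y) = a *\<^sub>C x + a *\<^sub>C y"
    and scaleC_add_left: "(a + b) *\<^sub>C x = a *\<^sub>C x + b *\<^sub>C x"
    and scaleC_scaleC: "a *\<^sub>C b *\<^sub>C x = (a * b) *\<^sub>C x"
    and scaleC_of_real: "complex_of_real r *\<^sub>C x = r *\<^sub>R x"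
    and norm_scaleC: "norm (a *\<^sub>C x) = cmod a * norm x"
    and mult_scaleC_left': "(a *\<^sub>C x) * y = a *\<^sub>C (x * y)"
    and mult_scaleC_right': "x * (a *\<^sub>C y) = a *\<^sub>C (x * y)"
    and mult_bounded: "\<exists>K. \<forall>x y. norm (x * y) \<le> K * norm x * norm y"

instantiation complex :: complex_banach_algebra
begin

definition "scaleC_complex = ((*) :: complex \<Rightarrow> complex \<Rightarrow> complex)"

instance
  by standard
    (auto simp: scaleC_complex_def algebra_simps norm_mult scaleR_conv_of_real intro!: exI[of _ 1])

end

text \<open>The product \<open>f 1 * f 2 * \<dots> * f l\<close> for \<open>l \<ge> 1\<close>, in this order (there is no unit, so the
  library's products do not apply).\<close>

definition ordered_prod :: "nat \<Rightarrow> (nat \<Rightarrow> 'b::times) \<Rightarrow> 'b" where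
  "ordered_prod l f = foldl (*) (f 1) (map f [2..<Suc l])"


section \<open>The Bochner integral without separability\<close>

text \<open>The Bochner integral of the library is restricted to second countable spaces.  This is
  literally its definition with that sort constraint dropped.\<close>

definition has_bochner :: "'a measure \<Rightarrow> ('a \<Rightarrow> 'b::real_normed_vector) \<Rightarrow> 'b \<Rightarrow> bool" where
  "has_bochner M f x \<longleftrightarrow> f \<in> borel_measurable M \<and>
     (\<exists>s. (\<forall>i::nat. Bochner_Integration.simple_bochner_integrable M (s i)) \<and>
          (\<lambda>i. \<integral>\<^sup>+y. ennreal (norm (f y - s i y)) \<partial>M) \<longlonglongrightarrow> 0 \<and>
          (\<lambda>i. Bochner_Integration.simple_bochner_integral M (s i)) \<longlonglongrightarrow> x)"

lemma has_bochner_eq_has_bochner_integral: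
  fixes f :: "'a \<Rightarrow> 'b::{real_normed_vector, second_countable_topology}"
  shows "has_bochner M f x \<longleftrightarrow> has_bochner_integral M f x"
  unfolding has_bochner_def
  by (auto intro: has_bochner_integral.intros elim!: has_bochner_integral.cases)

definition bochner :: "'a measure \<Rightarrow> ('a \<Rightarrow> 'b::real_normed_vector) \<Rightarrow> 'b" where
  "bochner M f = (THE x. has_bochner M f x)"


section \<open>The infinite-dimensional torus\<close>

text \<open>The torus is represented by its fundamental domain \<open>[0,1)^\<nat>\<close>; functions on the torus are only
  ever evaluated there.\<close>

definition torus :: "(nat \<Rightarrow> real) set" where
  "torus = UNIV \<rightarrow> {0..<1}"

definition torus_measure :: "(nat \<Rightarrow> real) measure" where
  "torus_measure = (\<Pi>\<^sub>M j\<in>UNIV. restrict_space lborel {0..<1})"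

definition rotation :: "(nat \<Rightarrow> real) \<Rightarrow> real \<Rightarrow> (nat \<Rightarrow> real) \<Rightarrow> (nat \<Rightarrow> real)" where
  "rotation \<rho> s \<theta> = (\<lambda>j. frac (\<theta> j + s * \<rho> j))"


section \<open>Integer vectors and the joint Diophantine conditions\<close>

definition jbracket :: "nat \<Rightarrow> real" where
  "jbracket j = real (max 1 j)"

definition int_vectors :: "nat \<Rightarrow> (nat \<Rightarrow> int) set" where
  "int_vectors \<eta> = {k. summable (\<lambda>j. jbracket j ^ \<eta> * real_of_int \<bar>k j\<bar>)}"

definition int_norm :: "nat \<Rightarrow> (nat \<Rightarrow> int) \<Rightarrow> real" where
  "int_norm \<eta> k = (\<Sum>j. jbracket j ^ \<eta> * real_of_int \<bar>k j\<bar>)"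

definition int_dot :: "(nat \<Rightarrow> int) \<Rightarrow> (nat \<Rightarrow> real) \<Rightarrow> real" where
  "int_dot k \<theta> = (\<Sum>j. real_of_int (k j) * \<theta> j)"

text \<open>Joint vectors \<open>k = (k 1, \<dots>, k l)\<close> and \<open>\<rho> = (\<rho> 1, \<dots>, \<rho> l)\<close> are functions of the index, used
  on \<open>{1..l}\<close> only.\<close>

definition joint_nonzero :: "nat \<Rightarrow> nat \<Rightarrow> (nat \<Rightarrow> nat \<Rightarrow> int) \<Rightarrow> bool" where
  "joint_nonzero l \<eta> k \<longleftrightarrow> (\<forall>i\<in>{1..l}. k i \<in> int_vectors \<eta>) \<and> (\<exists>i\<in>{1..l}. k i \<noteq> (\<lambda>_. 0))"

definition joint_dot :: "nat \<Rightarrow> (nat \<Rightarrow> nat \<Rightarrow> int) \<Rightarrow> (nat \<Rightarrow> nat \<Rightarrow> real) \<Rightarrow> real" where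
  "joint_dot l k \<rho> = (\<Sum>i=1..l. int_dot (k i) (\<rho> i))"

definition dioph_weight :: "nat \<Rightarrow> nat \<Rightarrow> (nat \<Rightarrow> nat \<Rightarrow> int) \<Rightarrow> real" where
  "dioph_weight l \<mu> k =
     (\<Prod>i=1..l. \<Prod>j. inverse (1 + real_of_int \<bar>k i j\<bar> ^ \<mu> * jbracket j ^ \<mu>))"

definition joint_diophantine_discrete ::
    "nat \<Rightarrow> nat \<Rightarrow> nat \<Rightarrow> (nat \<Rightarrow> nat \<Rightarrow> real) \<Rightarrow> bool" where
  "joint_diophantine_discrete l \<eta> \<mu> \<rho> \<longleftrightarrow>
     (\<exists>\<gamma>>0. \<forall>k. joint_nonzero l \<eta> k \<longrightarrow>
        (\<forall>n::int. \<bar>joint_dot l k \<rho> - of_int n\<bar> > \<gamma> * dioph_weight l \<mu> k))"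

definition joint_diophantine_continuous ::
    "nat \<Rightarrow> nat \<Rightarrow> nat \<Rightarrow> (nat \<Rightarrow> nat \<Rightarrow> real) \<Rightarrow> bool" where
  "joint_diophantine_continuous l \<eta> \<mu> \<rho> \<longleftrightarrow>
     (\<exists>\<gamma>>0. \<forall>k. joint_nonzero l \<eta> k \<longrightarrow> \<bar>joint_dot l k \<rho>\<bar> > \<gamma> * dioph_weight l \<mu> k)"


section \<open>Fourier series with values in a Banach algebra\<close>

definition fourier_coeff ::
    "((nat \<Rightarrow> real) \<Rightarrow> 'b::complex_banach_algebra) \<Rightarrow> (nat \<Rightarrow> int) \<Rightarrow> 'b" where
  "fourier_coeff f k = bochner torus_measure (\<lambda>\<theta>. cis (- (2 * pi * int_dot k \<theta>)) *\<^sub>C f \<theta>)"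

text \<open>Bochner integrability, without which the Fourier coefficients are not defined, is made
  explicit.\<close>

definition fourier_class ::
    "nat \<Rightarrow> (real \<Rightarrow> real) \<Rightarrow> ((nat \<Rightarrow> real) \<Rightarrow> 'b::complex_banach_algebra) set" where
  "fourier_class \<eta> \<Delta> = {f.
     (\<exists>x. has_bochner torus_measure f x) \<and>
     (\<forall>\<theta>\<in>torus. ((\<lambda>k. cis (2 * pi * int_dot k \<theta>) *\<^sub>C fourier_coeff f k)
        has_sum f \<theta>) (int_vectors \<eta>)) \<and>
     bdd_above ((\<lambda>k. \<Delta> (int_norm \<eta> k) * norm (fourier_coeff f k)) `
        (int_vectors \<eta> - {\<lambda>_. 0}))}"


section \<open>Weighted multiple averages\<close>

definition bump :: "real \<Rightarrow> real" where
  "bump x = exp (- (inverse x * inverse (1 - x)))"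

definition weight :: "real \<Rightarrow> real" where
  "weight x = (if 0 < x \<and> x < 1 then bump x / integral {0<..<1} bump else 0)"

definition DMW :: "nat \<Rightarrow> (nat \<Rightarrow> nat \<Rightarrow> real) \<Rightarrow>
    (nat \<Rightarrow> (nat \<Rightarrow> real) \<Rightarrow> 'b::complex_banach_algebra) \<Rightarrow> nat \<Rightarrow> (nat \<Rightarrow> real) \<Rightarrow> 'b" where
  "DMW l \<rho> F N \<theta> = (1 / (\<Sum>s<N. weight (real s / real N))) *\<^sub>R
     (\<Sum>n<N. weight (real n / real N) *\<^sub>R
        ordered_prod l (\<lambda>i. F i (rotation (\<rho> i) (real n) \<theta>)))"

definition CMW :: "nat \<Rightarrow> (nat \<Rightarrow> nat \<Rightarrow> real) \<Rightarrow>
    (nat \<Rightarrow> (nat \<Rightarrow> real) \<Rightarrow> 'b::complex_banach_algebra) \<Rightarrow> real \<Rightarrow> (nat \<Rightarrow> real) \<Rightarrow> 'b" where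
  "CMW l \<rho> F T \<theta> = (1 / T) *\<^sub>R
     integral {0..T} (\<lambda>s. weight (s / T) *\<^sub>R
        ordered_prod l (\<lambda>i. F i (rotation (\<rho> i) s \<theta>)))"

end

theory Submission
  imports Defs "HOL-Real_Asymp.Real_Asymp"
begin

text \<open>Expand every \<open>F i\<close> in its Fourier series along the orbit of \<open>\<theta>\<close>.  Since all coefficients are absolutely
summable, the product becomes one series over joint integer vectors \<open>\<kappa> = (\<kappa> 1, \<dots>, \<kappa> l)\<close>,
with terms \<open>cis (2 * pi * (\<Theta>\<^sub>\<kappa> + s * \<alpha>\<^sub>\<kappa>)) *\<^sub>C c\<^sub>\<kappa>\<close>, where \<open>\<alpha>\<^sub>\<kappa> = joint_dot l \<kappa> \<rho>\<close>
and \<open>c\<^sub>\<kappa>\<close> is the ordered product of the Fourier coefficients,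
whose zero term is the product of the integrals.  Averaging in \<open>s\<close> multiplies each other term by the
weighted mean of the character with frequency \<open>\<alpha>\<^sub>\<kappa>\<close>, so two quantities have to be compared.

\<^item> The weight is smooth and flat at both ends of \<open>[0,1]\<close>, and its \<open>m\<close>-th derivative is at most
  a constant times \<open>(2m+2)\<^sup>3\<^sup>m\<close>.  Summation by parts (integration by parts for the integral)
  repeated \<open>m\<close> times, with \<open>m\<close> about \<open>(T\<delta>)\<^sup>1\<^sup>/\<^sup>4\<close>, bounds the mean of a character by
  \<open>exp (-(T\<delta>)\<^sup>1\<^sup>/\<^sup>4)\<close> up to a factor \<open>C T\<close>, where \<open>\<delta>\<close> is the size of the divisor
  (\<open>discrete_mean_character_le\<close>, \<open>continuous_mean_character_le\<close>).  The Diophantine condition gives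
  \<open>\<delta> \<ge> \<gamma> exp (-\<mu> x)\<close>, where \<open>x\<close> is the sum of the norms of the components of \<open>\<kappa>\<close>
  (\<open>exp_le_dioph_weight\<close>).

\<^item> The coefficients decay doubly exponentially.  Half of the exponent makes the series over
  \<open>\<kappa>\<close> converge (\<open>exp_int_norm_summable\<close>), and the other half leaves a factor
  \<open>exp (-exp (x/l)/2)\<close> (\<open>prod_double_exp_le\<close>).

If \<open>exp (\<mu> x) \<le> T\<^sup>1\<^sup>/\<^sup>2\<close>, then \<open>T\<delta> \<ge> \<gamma> T\<^sup>1\<^sup>/\<^sup>2\<close> and the first bound wins.  Otherwise
\<open>exp (x/l)\<close> exceeds a fixed positive power of \<open>T\<close> and the second factor is small enough by
itself (\<open>coefficient_times_character_le\<close>).  Both regimes give \<open>exp (-T\<^sup>\<zeta>)\<close>, uniformly in \<open>\<kappa>\<close>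
and in \<open>\<theta>\<close>, with an exponent \<open>\<zeta>\<close> that depends on \<open>\<mu>\<close> and \<open>l\<close> only.\<close>

section \<open>Gevrey bounds for the bump function\<close>

text \<open>The functions \<open>x\<^sup>-\<^sup>i (1 - x)\<^sup>-\<^sup>j bump x\<close>, extended by zero, span a space that is closed under
differentiation, because \<open>bump x = exp (-1/x) exp (-1/(1-x))\<close>.\<close>
definition bump_term :: "nat \<Rightarrow> nat \<Rightarrow> real \<Rightarrow> real" where
  "bump_term i j x = (if 0 < x \<and> x < 1 then inverse x ^ i * inverse (1 - x) ^ j * bump x else 0)"

text \<open>The \<open>m\<close>-th derivative of \<open>bump_term i j\<close>.  Recursion on the order with both exponents as parameters
avoids Leibniz sums and keeps only four terms in each step.\<close>
fun bump_deriv :: "nat \<Rightarrow> nat \<Rightarrow> nat \<Rightarrow> real \<Rightarrow> real" where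
  "bump_deriv i j 0 x = bump_term i j x"
| "bump_deriv i j (Suc m) x =
     bump_deriv (i + 2) j m x - real i * bump_deriv (i + 1) j m x
     - bump_deriv i (j + 2) m x + real j * bump_deriv i (j + 1) m x"

lemma power_le_fact_mult_exp:
  fixes t :: real
  assumes "0 \<le> t"
  shows "t ^ n \<le> fact n * exp t"
proof -
  have "t ^ n / fact n \<le> (\<Sum>k. t ^ k / fact k)"
    using sum_le_suminf[OF summable_exp_generic[of t], of "{n}"] assms
    by (simp add: divide_inverse mult.commute)
  also have "\<dots> = exp t"
    by (simp add: exp_def divide_inverse mult.commute)
  finally show ?thesis
    by (simp add: divide_le_eq mult.commute)
qed

lemma bump_partial_fractions:
  assumes "0 < x" "x < 1"
  shows "bump x = exp (- inverse x) * exp (- inverse (1 - x))"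
proof -
  have "inverse x * inverse (1 - x) = inverse x + inverse (1 - x)"
    using assms by (simp add: field_simps)
  then show ?thesis by (simp add: bump_def exp_add [symmetric])
qed

lemma bump_term_nonneg: "0 \<le> bump_term i j x"
  by (simp add: bump_term_def bump_def)

text \<open>Near \<open>0\<close> and \<open>1\<close> the exponential beats the pole: \<open>t\<^sup>n exp (-t) \<le> n!\<close> for \<open>t = 1/x\<close> and \<open>t = 1/(1-x)\<close>.\<close>
lemma bump_term_le: "bump_term i j x \<le> fact (i + j)"
proof (cases "0 < x \<and> x < 1")
  case True
  have "inverse x ^ i * exp (- inverse x) \<le> fact i"
    using power_le_fact_mult_exp[of "inverse x" i] True
    by (simp add: exp_minus field_simps)
  moreover have "inverse (1 - x) ^ j * exp (- inverse (1 - x)) \<le> fact j"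
    using power_le_fact_mult_exp[of "inverse (1 - x)" j] True
    by (simp add: exp_minus field_simps)
  ultimately have "(inverse x ^ i * exp (- inverse x)) * (inverse (1 - x) ^ j * exp (- inverse (1 - x)))
      \<le> fact i * fact j"
    using True by (intro mult_mono) auto
  also have "(fact i * fact j :: real) \<le> fact (i + j)"
  proof -
    have "(fact i * fact j :: nat) dvd fact (i + j)" by (rule fact_fact_dvd_fact)
    then have "(fact i * fact j :: nat) \<le> fact (i + j)" by (rule dvd_imp_le) simp
    then have "real (fact i * fact j) \<le> real (fact (i + j))" by (rule of_nat_mono)
    then show ?thesis by simp
  qed
  finally show ?thesis
    using True by (simp add: bump_term_def bump_partial_fractions mult_ac)
qed (auto simp: bump_term_def)

lemma bump_term_shift_left: "bump_term i j x = x ^ n * bump_term (i + n) j x"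
  by (simp add: bump_term_def power_add field_simps)

lemma bump_term_shift_right: "bump_term i j x = (1 - x) ^ n * bump_term i (j + n) x"
  by (simp add: bump_term_def power_add field_simps)

lemma has_real_derivative_zero_if_quadratic:
  fixes f :: "real \<Rightarrow> real"
  assumes "\<And>y. \<bar>f y\<bar> \<le> C * (y - a)\<^sup>2"
  shows "(f has_real_derivative 0) (at a)"
proof -
  have "f a = 0" using assms[of a] by simp
  have C: "0 \<le> C" using assms[of "a + 1"] by simp
  have "((\<lambda>y. (f y - f a) / (y - a)) \<longlongrightarrow> 0) (at a)"
  proof (rule Lim_null_comparison)
    show "\<forall>\<^sub>F y in at a. norm ((f y - f a) / (y - a)) \<le> C * \<bar>y - a\<bar>"
    proof (rule eventuallyI)
      fix y
      show "norm ((f y - f a) / (y - a)) \<le> C * \<bar>y - a\<bar>"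
        using assms[of y] C \<open>f a = 0\<close>
        by (cases "y = a") (auto simp: divide_le_eq power2_eq_square mult.assoc)
    qed
    show "((\<lambda>y. C * \<bar>y - a\<bar>) \<longlongrightarrow> 0) (at a)"
      by (auto intro!: tendsto_eq_intros)
  qed
  then show ?thesis by (simp add: has_field_derivative_iff)
qed

text \<open>In the interior this is a computation.  At an end point the function is bounded by a multiple of the squared
distance, since two powers of \<open>x\<close> (or of \<open>1 - x\<close>) can be split off and the remaining quotient is again
bounded by \<open>bump_term_le\<close>.\<close>
lemma has_real_derivative_bump_term:
  "(bump_term i j has_real_derivative bump_deriv i j 1 x) (at x)"
proof -
  consider "x < 0 \<or> 1 < x" | "x = 0" | "x = 1" | "0 < x" "x < 1" by linarith
  then show ?thesis
  proof cases
    case 1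
    then have "((\<lambda>_. 0) has_real_derivative bump_deriv i j 1 x) (at x)"
      by (auto simp: bump_term_def)
    then show ?thesis
      by (rule has_field_derivative_transform_within_open[where S = "{..<0} \<union> {1<..}"])
        (use 1 in \<open>auto simp: bump_term_def\<close>)
  next
    case 2
    have "\<bar>bump_term i j y\<bar> \<le> fact (i + 2 + j) * (y - 0)\<^sup>2" for y
      using bump_term_shift_left[of i j y 2] bump_term_le[of "i + 2" j y]
        bump_term_nonneg[of "i + 2" j y]
      by (simp add: mult.commute[of "fact _"] mult_left_mono del: fact_Suc add_2_eq_Suc add_2_eq_Suc')
    then have "(bump_term i j has_real_derivative 0) (at 0)"
      by (rule has_real_derivative_zero_if_quadratic)
    moreover have "bump_deriv i j 1 x = 0" using 2 by (simp add: bump_term_def)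
    ultimately show ?thesis using 2 by (simp del: bump_deriv.simps)
  next
    case 3
    have "\<bar>bump_term i j y\<bar> \<le> fact (i + (j + 2)) * (y - 1)\<^sup>2" for y
      using bump_term_shift_right[of i j y 2] bump_term_le[of i "j + 2" y]
        bump_term_nonneg[of i "j + 2" y]
      by (simp add: mult.commute[of "fact _"] power2_commute[of y] mult_left_mono del: fact_Suc add_2_eq_Suc add_2_eq_Suc')
    then have "(bump_term i j has_real_derivative 0) (at 1)"
      by (rule has_real_derivative_zero_if_quadratic)
    moreover have "bump_deriv i j 1 x = 0" using 3 by (simp add: bump_term_def)
    ultimately show ?thesis using 3 by (simp del: bump_deriv.simps)
  next
    case 4
    let ?a = "inverse x" and ?b = "inverse (1 - x)"
    have pow: "((\<lambda>z. inverse z ^ n) has_real_derivative - (real n * inverse y ^ (n + 1))) (at y)"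
      if "y \<noteq> 0" for n and y :: real
    proof -
      have "((\<lambda>z. inverse z ^ n) has_real_derivative
          real n * (- (inverse y ^ 2) * inverse y ^ (n - 1))) (at y)"
        using that by (auto intro!: derivative_eq_intros simp: power2_eq_square)
      then show ?thesis by (cases n) (auto simp: power2_eq_square algebra_simps)
    qed
    have pow': "((\<lambda>z. inverse (1 - z) ^ n) has_real_derivative real n * ?b ^ (n + 1)) (at x)" for n
    proof -
      have "((\<lambda>z. 1 - z) has_real_derivative -1) (at x)"
        by (auto intro!: derivative_eq_intros)
      from DERIV_chain2[where f = "\<lambda>z. inverse z ^ n" and g = "\<lambda>z. 1 - z", OF pow this] 4
      show ?thesis by simp
    qed
    have exp1: "((\<lambda>z. exp (- inverse z)) has_real_derivative exp (- ?a) * ?a ^ 2) (at x)"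
    proof -
      have "((\<lambda>z. - inverse z) has_real_derivative ?a ^ 2) (at x)"
        using DERIV_minus[OF pow[of x 1]] 4 by (simp add: power2_eq_square)
      from DERIV_chain2[where f = exp and g = "\<lambda>z. - inverse z", OF DERIV_exp this]
      show ?thesis .
    qed
    have exp2: "((\<lambda>z. exp (- inverse (1 - z))) has_real_derivative - (exp (- ?b) * ?b ^ 2)) (at x)"
    proof -
      have "((\<lambda>z. - inverse (1 - z)) has_real_derivative - (?b ^ 2)) (at x)"
        using DERIV_minus[OF pow'[of 1]] by (simp add: power2_eq_square)
      from DERIV_chain2[where f = exp and g = "\<lambda>z. - inverse (1 - z)", OF DERIV_exp this]
      show ?thesis by simp
    qed
    have "((\<lambda>z. (inverse z ^ i * inverse (1 - z) ^ j) * (exp (- inverse z) * exp (- inverse (1 - z))))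
        has_real_derivative bump_deriv i j 1 x) (at x)"
      by (rule DERIV_cong[OF DERIV_mult[OF DERIV_mult[OF pow pow'] DERIV_mult[OF exp1 exp2]]])
        (use 4 in \<open>simp_all add: bump_term_def bump_partial_fractions algebra_simps power_add
          power2_eq_square\<close>)
    then show ?thesis
      by (rule has_field_derivative_transform_within_open[where S = "{0<..<1}"])
         (use 4 in \<open>auto simp: bump_term_def bump_partial_fractions\<close>)
  qed
qed

lemma has_real_derivative_bump_deriv:
  "(bump_deriv i j m has_real_derivative bump_deriv i j (Suc m) x) (at x)"
proof (induction m arbitrary: i j)
  case 0
  then show ?case using has_real_derivative_bump_term[of i j x]
    by (simp add: ext[of "bump_deriv i j 0"])
next
  case (Suc m)
  have e: "bump_deriv i j (Suc m) = (\<lambda>x. bump_deriv (i + 2) j m x - real i * bump_deriv (i + 1) j m x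
     - bump_deriv i (j + 2) m x + real j * bump_deriv i (j + 1) m x)"
    by auto
  show ?case
    unfolding e bump_deriv.simps(2)[of i j "Suc m"]
    by (intro DERIV_add DERIV_diff DERIV_cmult Suc.IH)
qed

lemma bump_deriv_outside: "x \<le> 0 \<or> 1 \<le> x \<Longrightarrow> bump_deriv i j m x = 0"
  by (induction m arbitrary: i j) (auto simp: bump_term_def)

text \<open>One step of the recursion produces four terms with total weight \<open>2 + i + j\<close>, and raises \<open>i + j\<close> by at
most \<open>2\<close>; the factorial is the bound for the terms that are left after \<open>m\<close> steps.\<close>
lemma abs_bump_deriv_le:
  "\<bar>bump_deriv i j m x\<bar> \<le> real (2 + i + j + 2 * m) ^ m * fact (i + j + 2 * m)"
proof (induction m arbitrary: i j)
  case 0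
  then show ?case using bump_term_le[of i j x] bump_term_nonneg[of i j x] by simp
next
  case (Suc m)
  define B :: real where "B = real (2 + i + j + 2 * Suc m) ^ m * fact (i + j + 2 * Suc m)"
  have le: "\<bar>bump_deriv i' j' m x\<bar> \<le> B" if "i' + j' \<le> i + j + 2" for i' j'
  proof -
    have "real (2 + i' + j' + 2 * m) ^ m * fact (i' + j' + 2 * m) \<le> B"
      unfolding B_def using that by (intro mult_mono power_mono fact_mono) auto
    with Suc.IH[of i' j'] show ?thesis by simp
  qed
  have "\<bar>bump_deriv i j (Suc m) x\<bar> \<le> \<bar>bump_deriv (i + 2) j m x\<bar> + real i * \<bar>bump_deriv (i + 1) j m x\<bar>
     + \<bar>bump_deriv i (j + 2) m x\<bar> + real j * \<bar>bump_deriv i (j + 1) m x\<bar>"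
  proof -
    have "\<bar>real n * y\<bar> = real n * \<bar>y\<bar>" for n and y :: real by (simp add: abs_mult)
    from this[of i "bump_deriv (i + 1) j m x"] this[of j "bump_deriv i (j + 1) m x"]
    show ?thesis unfolding bump_deriv.simps by linarith
  qed
  also have "\<dots> \<le> B + real i * B + B + real j * B"
    by (intro add_mono mult_left_mono) (rule le, simp | simp)+
  also have "\<dots> = real (2 + i + j) * B" by (simp add: algebra_simps)
  also have "\<dots> \<le> real (2 + i + j + 2 * Suc m) * B"
    by (intro mult_right_mono) (auto simp: B_def)
  finally show ?case by (simp add: B_def)
qed

lemma abs_bump_deriv_0_le: "\<bar>bump_deriv 0 0 m x\<bar> \<le> ((2 * real m + 2) ^ 3) ^ m"
proof -
  have "fact (2 * m) \<le> real (2 * m) ^ (2 * m)"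
    unfolding of_nat_power [symmetric] by (rule fact_le_power)
  also have "\<dots> \<le> (2 * real m + 2) ^ (2 * m)" by (intro power_mono) auto
  finally have "real (2 + 2 * m) ^ m * fact (2 * m) \<le> (2 * real m + 2) ^ m * (2 * real m + 2) ^ (2 * m)"
    by (intro mult_mono) (auto simp: add.commute)
  also have "\<dots> = ((2 * real m + 2) ^ 3) ^ m"
    by (simp flip: power_mult power_add)
  finally show ?thesis using abs_bump_deriv_le[of 0 0 m x] by simp
qed

section \<open>Oscillating sums and integrals of the bump function\<close>

text \<open>The weight before normalization, as the start of its own chain of derivatives.\<close>
definition cutoff :: "real \<Rightarrow> real" where
  "cutoff = bump_deriv 0 0 0"

definition bdiff :: "real \<Rightarrow> (real \<Rightarrow> real) \<Rightarrow> real \<Rightarrow> real" where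
  "bdiff h f x = f x - f (x - h)"

text \<open>The mean value theorem turns each difference into \<open>h\<close> times a derivative.  The induction is over whole
chains of derivatives, because the differences of a chain form a chain again.\<close>
lemma abs_iterated_bdiff_le:
  fixes d :: "nat \<Rightarrow> real \<Rightarrow> real"
  assumes deriv: "\<And>i x. (d i has_real_derivative d (Suc i) x) (at x)"
    and bound: "\<And>x. \<bar>d m x\<bar> \<le> B" and "0 < h"
  shows "\<bar>(bdiff h ^^ m) (d 0) x\<bar> \<le> h ^ m * B"
  using deriv bound
proof (induction m arbitrary: d B)
  case 0
  then show ?case by simp
next
  case (Suc m)
  have *: "((\<lambda>x. bdiff h (d i) x) has_real_derivative bdiff h (d (Suc i)) x) (at x)" for i x
    unfolding bdiff_def
    using Suc.prems(1)[of i "x - h"] DERIV_shift[of "d i" "d (Suc i) (x - h)" x "- h"]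
    by (intro DERIV_diff Suc.prems(1)) simp
  have bnd: "\<bar>bdiff h (d m) x\<bar> \<le> h * B" for x
  proof -
    obtain z where "d m x - d m (x - h) = (x - (x - h)) * d (Suc m) z"
      using MVT2[of "x - h" x "d m" "d (Suc m)"] Suc.prems(1) \<open>0 < h\<close> by auto
    then show ?thesis
      using Suc.prems(2)[of z] \<open>0 < h\<close> by (simp add: bdiff_def abs_mult)
  qed
  have "\<bar>(bdiff h ^^ m) (bdiff h (d 0)) x\<bar> \<le> h ^ m * (h * B)"
    by (rule Suc.IH[of "\<lambda>i. bdiff h (d i)", OF * bnd])
  then show ?case by (simp add: funpow_Suc_right mult_ac del: funpow.simps)
qed

text \<open>Abel summation without boundary terms, as \<open>f\<close> vanishes on both sides.  Every step enlarges the support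
by one grid point, hence the upper limit \<open>L + m\<close>.\<close>
lemma summation_by_parts_bdiff:
  fixes z :: complex
  assumes "\<And>x. x < 0 \<Longrightarrow> f x = 0" "\<And>x. real L * h \<le> x \<Longrightarrow> f x = 0" and "0 < h"
  shows "(1 - z) ^ m * (\<Sum>n<L. of_real (f (real n * h)) * z ^ n)
       = (\<Sum>n<L+m. of_real ((bdiff h ^^ m) f (real n * h)) * z ^ n)"
  using assms(1,2)
proof (induction m arbitrary: f L)
  case 0
  then show ?case by simp
next
  case (Suc m)
  let ?G = "\<lambda>f L. \<Sum>n<L. of_real (f (real n * h)) * z ^ n"
  have "?G (bdiff h f) (Suc L) = ?G f (Suc L) - (\<Sum>n<Suc L. of_real (f (real n * h - h)) * z ^ n)"
    by (simp add: bdiff_def algebra_simps sum_subtractf)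
  also have "?G f (Suc L) = ?G f L"
    using Suc.prems(2)[of "real L * h"] by simp
  also have "(\<Sum>n<Suc L. of_real (f (real n * h - h)) * z ^ n) = z * ?G f L"
    using Suc.prems(1)[of "- h"] \<open>0 < h\<close>
    by (subst sum.lessThan_Suc_shift) (simp add: sum_distrib_left algebra_simps)
  finally have "(1 - z) * ?G f L = ?G (bdiff h f) (Suc L)"
    by (simp add: algebra_simps)
  moreover have "(1 - z) ^ m * ?G (bdiff h f) (Suc L) = ?G ((bdiff h ^^ m) (bdiff h f)) (Suc L + m)"
    by (rule Suc.IH) (use Suc.prems \<open>0 < h\<close> in \<open>auto simp: bdiff_def algebra_simps\<close>)
  ultimately show ?case
    by (simp add: funpow_Suc_right power_Suc2 mult.assoc del: funpow.simps power_Suc sum.lessThan_Suc)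
qed

lemma cutoff_outside: "x \<le> 0 \<or> 1 \<le> x \<Longrightarrow> cutoff x = 0"
  by (simp add: cutoff_def bump_deriv_outside del: bump_deriv.simps)

text \<open>Summation by parts at mesh \<open>1 / N\<close>, for an arbitrary number \<open>m\<close> of steps; the choice of \<open>m\<close> is
postponed to \<open>stretched_exponential_from_all_orders\<close>.\<close>
lemma norm_cutoff_exponential_sum_le:
  assumes "N > 0" "cmod z = 1" "z \<noteq> 1"
  shows "cmod (\<Sum>n<N. of_real (cutoff (real n / real N)) * z ^ n)
     \<le> real N * ((1 + real m) * ((2 * real m + 2) ^ 3 / (real N * cmod (1 - z))) ^ m)"
proof -
  let ?h = "1 / real N" and ?B = "((2 * real m + 2) ^ 3) ^ m"
  have h: "0 < ?h" using assms by simp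
  have "(1 - z) ^ m * (\<Sum>n<N. of_real (cutoff (real n * ?h)) * z ^ n)
       = (\<Sum>n<N+m. of_real ((bdiff ?h ^^ m) cutoff (real n * ?h)) * z ^ n)"
    using assms by (intro summation_by_parts_bdiff) (auto intro!: cutoff_outside)
  then have "cmod (1 - z) ^ m * cmod (\<Sum>n<N. of_real (cutoff (real n * ?h)) * z ^ n)
       = cmod (\<Sum>n<N+m. of_real ((bdiff ?h ^^ m) cutoff (real n * ?h)) * z ^ n)"
    unfolding norm_mult [symmetric] norm_power [symmetric] by simp
  also have "\<dots> \<le> (\<Sum>n<N+m. ?h ^ m * ?B)"
  proof (rule sum_norm_le)
    fix n
    have "\<bar>(bdiff ?h ^^ m) (bump_deriv 0 0 0) (real n * ?h)\<bar> \<le> ?h ^ m * ?B"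
      by (rule abs_iterated_bdiff_le[of "bump_deriv 0 0", OF has_real_derivative_bump_deriv abs_bump_deriv_0_le h])
    then show "cmod (of_real ((bdiff ?h ^^ m) cutoff (real n * ?h)) * z ^ n) \<le> ?h ^ m * ?B"
      using assms by (simp add: norm_mult norm_power cutoff_def)
  qed
  also have "\<dots> = real (N + m) * (?h ^ m * ?B)" by simp
  also have "\<dots> \<le> (real N * (1 + real m)) * (?h ^ m * ?B)"
  proof (rule mult_right_mono)
    have "real m \<le> real N * real m" using mult_right_mono[of 1 "real N" "real m"] assms by simp
    then show "real (N + m) \<le> real N * (1 + real m)" by (simp add: algebra_simps)
  qed simp
  finally have "cmod (1 - z) ^ m * cmod (\<Sum>n<N. of_real (cutoff (real n * ?h)) * z ^ n)
     \<le> (real N * (1 + real m)) * (?h ^ m * ?B)" .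
  then have "cmod (\<Sum>n<N. of_real (cutoff (real n * ?h)) * z ^ n)
     \<le> (real N * (1 + real m)) * (?h ^ m * ?B) / cmod (1 - z) ^ m"
    using assms by (subst pos_le_divide_eq) (auto simp: mult.commute)
  also have "\<dots> = real N * ((1 + real m) * ((2 * real m + 2) ^ 3 / (real N * cmod (1 - z))) ^ m)"
    by (simp add: power_divide power_mult_distrib)
  finally show ?thesis by simp
qed

lemma continuous_on_bump_deriv: "continuous_on A (bump_deriv i j m)"
  by (rule DERIV_continuous_on, rule has_field_derivative_at_within, rule has_real_derivative_bump_deriv)

lemma continuous_on_cutoff: "continuous_on A cutoff"
  unfolding cutoff_def by (rule continuous_on_bump_deriv)

lemma cutoff_nonneg: "0 \<le> cutoff x"
  by (simp add: cutoff_def bump_term_nonneg)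

lemma cutoff_pos: "0 < x \<Longrightarrow> x < 1 \<Longrightarrow> 0 < cutoff x"
  by (simp add: cutoff_def bump_term_def bump_def)

lemma cutoff_ge_middle:
  assumes "1/4 \<le> x" "x \<le> 3/4"
  shows "exp (- 16) \<le> cutoff x"
proof -
  have "inverse x \<le> 4" "inverse (1 - x) \<le> 4" using assms by (auto simp: field_simps)
  then have "inverse x * inverse (1 - x) \<le> 4 * 4" using assms by (intro mult_mono) auto
  then show ?thesis using assms by (simp add: cutoff_def bump_term_def bump_def)
qed

lemma weight_eq_cutoff: "weight x = cutoff x / integral {0..1} cutoff"
proof -
  have "integral {0..1} cutoff = integral {0<..<1} cutoff"
    using integral_open_interval_real[of 0 1 cutoff] by simp
  also have "\<dots> = integral {0<..<1} bump"
    by (rule integral_cong) (simp add: cutoff_def bump_term_def)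
  finally have "integral {0..1} cutoff = integral {0<..<1} bump" .
  moreover have "cutoff x = (if 0 < x \<and> x < 1 then bump x else 0)"
    by (simp add: cutoff_def bump_term_def)
  ultimately show ?thesis by (simp add: weight_def)
qed

lemma integral_cutoff_pos: "0 < integral {0..1} cutoff"
proof -
  have "integral {0..1} cutoff \<noteq> 0"
  proof
    assume "integral {0..1} cutoff = 0"
    then have "\<forall>x\<in>{0..1}. cutoff x = 0"
      using integral_eq_0_iff[of 0 1 cutoff] by (simp add: continuous_on_cutoff cutoff_nonneg)
    then have "cutoff (1 / 2) = 0" by simp
    with cutoff_pos[of "1 / 2"] show False by simp
  qed
  moreover have "0 \<le> integral {0..1} cutoff"
    by (rule integral_nonneg[OF integrable_continuous_interval[OF continuous_on_cutoff] cutoff_nonneg])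
  ultimately show ?thesis by simp
qed

text \<open>Every derivative of the cutoff vanishes at \<open>0\<close> and \<open>1\<close>, so that integration by parts has no boundary
terms and each step costs a factor \<open>1 / \<bar>\<beta>\<bar>\<close>.\<close>
lemma cmod_cutoff_fourier_integral_le:
  assumes "\<beta> \<noteq> 0"
  shows "cmod (integral {0..1} (\<lambda>x. of_real (cutoff x) * cis (\<beta> * x)))
     \<le> ((2 * real m + 2) ^ 3 / \<bar>\<beta>\<bar>) ^ m"
proof -
  let ?d = "bump_deriv 0 0"
  let ?I = "\<lambda>m. integral {0..1} (\<lambda>x. of_real (?d m x) * cis (\<beta> * x))"
  have cont: "continuous_on A (\<lambda>x. of_real (?d m x) * cis (\<beta> * x))" for A m
    by (intro continuous_intros continuous_on_bump_deriv)
  have parts: "cmod (?I (Suc m)) = \<bar>\<beta>\<bar> * cmod (?I m)" for m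
  proof -
    have ftc: "((\<lambda>x. of_real (?d (Suc m) x) * cis (\<beta> * x) + \<i> * of_real \<beta> * (of_real (?d m x) * cis (\<beta> * x)))
      has_integral (of_real (?d m 1) * cis (\<beta> * 1) - of_real (?d m 0) * cis (\<beta> * 0))) {0..1}"
    proof (rule fundamental_theorem_of_calculus)
      fix x :: real
      have 1: "((\<lambda>x. complex_of_real (?d m x)) has_vector_derivative of_real (?d (Suc m) x)) (at x within {0..1})"
        using has_real_derivative_bump_deriv[of 0 0 m x]
        by (intro has_vector_derivative_of_real has_vector_derivative_at_within)
           (simp add: has_real_derivative_iff_has_vector_derivative del: bump_deriv.simps)
      have 2: "((\<lambda>x. cis (\<beta> * x)) has_vector_derivative \<i> * of_real \<beta> * cis (\<beta> * x)) (at x within {0..1})"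
      proof -
        have "((\<lambda>z. exp (\<i> * of_real \<beta> * z)) has_field_derivative
            \<i> * of_real \<beta> * exp (\<i> * of_real \<beta> * of_real x)) (at (of_real x))"
          by (auto intro!: derivative_eq_intros)
        from has_vector_derivative_real_field[OF this]
        show ?thesis by (simp add: cis_conv_exp mult.assoc)
      qed
      show "((\<lambda>x. of_real (?d m x) * cis (\<beta> * x)) has_vector_derivative
         (of_real (?d (Suc m) x) * cis (\<beta> * x) + \<i> * of_real \<beta> * (of_real (?d m x) * cis (\<beta> * x)))) (at x within {0..1})"
        using has_vector_derivative_mult[OF 1 2] by (simp add: algebra_simps del: bump_deriv.simps)
    qed auto
    have lin: "((\<lambda>x. of_real (?d (Suc m) x) * cis (\<beta> * x) + \<i> * of_real \<beta> * (of_real (?d m x) * cis (\<beta> * x)))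
      has_integral (?I (Suc m) + \<i> * of_real \<beta> * ?I m)) {0..1}"
      by (intro has_integral_add has_integral_mult_right integrable_integral integrable_continuous_interval cont)
    have "?I (Suc m) + \<i> * of_real \<beta> * ?I m = 0"
      using has_integral_unique[OF lin ftc] by (simp add: bump_deriv_outside del: bump_deriv.simps)
    then have "?I (Suc m) = - (\<i> * of_real \<beta> * ?I m)" by (simp add: add_eq_0_iff2 del: bump_deriv.simps)
    then show ?thesis by (simp add: norm_mult del: bump_deriv.simps)
  qed
  have "\<bar>\<beta>\<bar> ^ m * cmod (?I 0) = cmod (?I m)"
  proof (induction m)
    case (Suc m)
    then show ?case by (simp add: parts mult.assoc del: bump_deriv.simps)
  qed simp
  also have "cmod (?I m) \<le> ((2 * real m + 2) ^ 3) ^ m * (1 - 0)"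
  proof (rule integral_bound)
    show "\<And>x. x \<in> {0..1} \<Longrightarrow> cmod (complex_of_real (?d m x) * cis (\<beta> * x)) \<le> ((2 * real m + 2) ^ 3) ^ m"
      using abs_bump_deriv_0_le by (simp add: norm_mult del: bump_deriv.simps)
  qed (auto intro: cont)
  finally have "\<bar>\<beta>\<bar> ^ m * cmod (?I 0) \<le> ((2 * real m + 2) ^ 3) ^ m" by simp
  then have "cmod (?I 0) \<le> ((2 * real m + 2) ^ 3) ^ m / \<bar>\<beta>\<bar> ^ m"
    using assms by (subst pos_le_divide_eq) (auto simp: mult.commute)
  then show ?thesis by (simp add: cutoff_def power_divide)
qed

text \<open>For \<open>m\<close> close to \<open>y\<^sup>1\<^sup>/\<^sup>4\<close> the base \<open>(2m+2)\<^sup>3 / y\<close> is about \<open>8 y\<^sup>-\<^sup>1\<^sup>/\<^sup>4\<close>.  Once this is below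
\<open>exp (-2)\<close>, one half of the exponent absorbs the factor \<open>1 + m\<close> and the other half is the claimed
decay.  For bounded \<open>y\<close> the order \<open>m = 0\<close> suffices.\<close>
lemma stretched_exponential_from_all_orders:
  obtains C :: real where "C > 0" "\<And>X P y. 0 < y \<Longrightarrow> 0 \<le> P \<Longrightarrow> (\<And>m::nat. X \<le> P * ((1 + real m) * ((2 * real m + 2) ^ 3 / y) ^ m))
     \<Longrightarrow> X \<le> P * (C * exp (- (y powr (1/4))))"
proof -
  \<comment> \<open>For \<open>r = y\<^sup>1\<^sup>/\<^sup>4 \<ge> R \<ge> 1\<close> one has \<open>(2m+2)\<^sup>3 \<le> (4r)\<^sup>3\<close>, and \<open>64 / r \<le> exp (-2)\<close> is what is needed.\<close>
  define R :: real where "R = 64 * exp 2 + 1"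
  show ?thesis
  proof (rule that[of "exp R"])
    fix X P y :: real
    assume y: "0 < y" and P: "0 \<le> P" and b: "\<And>m::nat. X \<le> P * ((1 + real m) * ((2 * real m + 2) ^ 3 / y) ^ m)"
    define r where "r = y powr (1/4)"
    have r: "0 < r" "y = r ^ 4"
      using y powr_realpow[of "y powr (1/4)" 4] by (auto simp: r_def powr_powr)
    show "X \<le> P * (exp R * exp (- (y powr (1/4))))"
    proof (cases "r \<le> R")
      case True
      have "X \<le> P * 1" using b[of 0] by simp
      also have "\<dots> \<le> P * (exp R * exp (- r))"
        using True P by (intro mult_left_mono) (auto simp flip: exp_add)
      finally show ?thesis by (simp add: r_def)
    next
      case False
      define m where "m = nat \<lfloor>r\<rfloor>"
      have R1: "1 \<le> R" by (simp add: R_def)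
      have m: "real m \<le> r" "r \<le> real m + 1" using r by (auto simp: m_def)
      have "(2 * real m + 2) ^ 3 \<le> (4 * r) ^ 3" using m False R1 by (intro power_mono) auto
      then have "(2 * real m + 2) ^ 3 / y \<le> (4 * r) ^ 3 / y" using y by (intro divide_right_mono) auto
      also have "\<dots> = 64 / r" using r by (simp add: power_mult_distrib field_simps power_numeral_reduce)
      also have "\<dots> \<le> 64 / (64 * exp 2)" using False r by (intro divide_left_mono) (auto simp: R_def)
      also have "\<dots> = exp (- 2)" by (simp add: exp_minus field_simps)
      finally have "((2 * real m + 2) ^ 3 / y) ^ m \<le> exp (- 2) ^ m" using y by (intro power_mono) auto
      moreover have "1 + real m \<le> exp (real m)" by (rule exp_ge_add_one_self)
      ultimately have "(1 + real m) * ((2 * real m + 2) ^ 3 / y) ^ m \<le> exp (real m) * exp (- 2) ^ m"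
        using y by (intro mult_mono) auto
      also have "\<dots> = exp (- real m)" by (simp flip: exp_of_nat_mult exp_add)
      also have "\<dots> \<le> exp (R - r)" using m R1 by simp
      finally have "P * ((1 + real m) * ((2 * real m + 2) ^ 3 / y) ^ m) \<le> P * exp (R - r)"
        using P by (rule mult_left_mono)
      also have "exp (R - r) = exp R * exp (- r)" by (simp flip: exp_add)
      finally show ?thesis using b[of m] by (simp add: r_def)
    qed
  qed auto
qed

text \<open>The chord has length \<open>2 \<bar>sin (\<pi>t)\<bar>\<close>, where \<open>t\<close> is \<open>\<alpha>\<close> minus its nearest integer.  The constant \<open>1\<close> is
far from the optimal \<open>4\<close> but suffices here.\<close>
lemma cmod_one_minus_cis_ge:
  assumes "\<And>n::int. \<delta> \<le> \<bar>\<alpha> - of_int n\<bar>"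
  shows "\<delta> \<le> cmod (1 - cis (2 * pi * \<alpha>))"
proof -
  define t where "t = \<alpha> - of_int (round \<alpha>)"
  have t: "\<bar>t\<bar> \<le> 1 / 2" "\<delta> \<le> \<bar>t\<bar>"
    using of_int_round_abs_le[of \<alpha>] assms[of "round \<alpha>"] by (auto simp: t_def abs_minus_commute)
  have "cis (2 * pi * \<alpha>) = cis (2 * pi * t) * cis (2 * pi * of_int (round \<alpha>))"
    by (simp add: t_def cis_mult algebra_simps)
  also have "cis (2 * pi * of_int (round \<alpha>)) = 1" by (rule cis_multiple_2pi) simp
  finally have e: "cis (2 * pi * \<alpha>) = cis (2 * pi * t)" by simp
  have "(cmod (1 - cis (2 * pi * t)))\<^sup>2 = (1 - cos (2 * pi * t))\<^sup>2 + (sin (2 * pi * t))\<^sup>2"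
    by (simp add: cmod_power2)
  also have "\<dots> = (2 * sin (pi * t))\<^sup>2"
  proof -
    have "cos (2 * (pi * t)) = 1 - 2 * (sin (pi * t))\<^sup>2" by (rule cos_double_sin)
    then show ?thesis
      using sin_cos_squared_add[of "2 * (pi * t)"] by (simp add: power2_eq_square algebra_simps)
  qed
  finally have m: "cmod (1 - cis (2 * pi * t)) = 2 * \<bar>sin (pi * t)\<bar>"
  proof -
    assume "(cmod (1 - cis (2 * pi * t)))\<^sup>2 = (2 * sin (pi * t))\<^sup>2"
    then have "(cmod (1 - cis (2 * pi * t)))\<^sup>2 = (2 * \<bar>sin (pi * t)\<bar>)\<^sup>2"
      by (simp add: power_mult_distrib)
    then show ?thesis by (rule power2_eq_imp_eq) auto
  qed
  have "\<bar>t\<bar> \<le> 2 * sin (pi * \<bar>t\<bar>)"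
  proof (cases "\<bar>t\<bar> \<le> 1 / 6")
    case True
    show ?thesis
    proof (cases "t = 0")
      case False
      obtain \<xi> where \<xi>: "0 < \<xi>" "\<xi> < pi * \<bar>t\<bar>" "sin (pi * \<bar>t\<bar>) - sin 0 = (pi * \<bar>t\<bar> - 0) * cos \<xi>"
        using MVT2[of 0 "pi * \<bar>t\<bar>" sin cos] False by auto
      have "pi * \<bar>t\<bar> \<le> pi * (1 / 6)" using True by (intro mult_left_mono) auto
      then have "\<xi> \<le> pi / 3" using \<xi> pi_gt_zero by linarith
      then have "cos (pi / 3) \<le> cos \<xi>"
        using \<xi> pi_gt_zero by (intro cos_monotone_0_pi_le) linarith+
      then have "1 / 2 \<le> cos \<xi>" by (simp add: cos_60)
      moreover have "\<bar>t\<bar> \<le> pi * \<bar>t\<bar>" using mult_right_mono[of 1 pi "\<bar>t\<bar>"] pi_gt3 by simp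
      ultimately have "\<bar>t\<bar> * (1 / 2) \<le> pi * \<bar>t\<bar> * cos \<xi>" by (intro mult_mono) auto
      then show ?thesis using \<xi> by simp
    qed auto
  next
    case False
    have "pi * (1 / 6) \<le> pi * \<bar>t\<bar>" using False by (intro mult_left_mono) auto
    moreover have "pi * \<bar>t\<bar> \<le> pi * (1 / 2)" using t by (intro mult_left_mono) auto
    ultimately have "sin (pi / 6) \<le> sin (pi * \<bar>t\<bar>)"
      using pi_gt_zero by (intro sin_monotone_2pi_le) linarith+
    then show ?thesis using t by (simp add: sin_30)
  qed
  also have "\<dots> \<le> 2 * \<bar>sin (pi * t)\<bar>" by (cases "0 \<le> t") auto
  finally show ?thesis using e m t by simp
qed

section \<open>Integer vectors on the infinite torus\<close>

lemma jbracket_ge_1: "1 \<le> jbracket j"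
  by (simp add: jbracket_def)

lemma jbracket_ge: "real j \<le> jbracket j"
  by (simp add: jbracket_def)

lemma int_vectors_finite_support:
  assumes "k \<in> int_vectors \<eta>"
  shows "finite {j. k j \<noteq> 0}"
proof -
  have "(\<lambda>j. jbracket j ^ \<eta> * real_of_int \<bar>k j\<bar>) \<longlonglongrightarrow> 0"
    using assms by (intro summable_LIMSEQ_zero) (simp add: int_vectors_def)
  then have "\<forall>\<^sub>F j in sequentially. jbracket j ^ \<eta> * real_of_int \<bar>k j\<bar> < 1"
    by (rule order_tendstoD) simp
  then obtain n where n: "\<And>j. n \<le> j \<Longrightarrow> jbracket j ^ \<eta> * real_of_int \<bar>k j\<bar> < 1"
    by (auto simp: eventually_sequentially)
  have "k j = 0" if "n \<le> j" for j
  proof (rule ccontr)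
    assume "k j \<noteq> 0"
    then have "1 \<le> real_of_int \<bar>k j\<bar>" by linarith
    then have "1 * 1 \<le> jbracket j ^ \<eta> * real_of_int \<bar>k j\<bar>"
      using one_le_power[OF jbracket_ge_1[of j], of \<eta>] by (intro mult_mono) linarith+
    with n[OF that] show False by simp
  qed
  then have "{j. k j \<noteq> 0} \<subseteq> {..<n}" by (force simp: not_le[symmetric])
  then show ?thesis by (rule finite_subset) simp
qed

lemma int_norm_eq_sum:
  assumes "finite A" "{j. k j \<noteq> 0} \<subseteq> A"
  shows "int_norm \<eta> k = (\<Sum>j\<in>A. jbracket j ^ \<eta> * real_of_int \<bar>k j\<bar>)"
  unfolding int_norm_def using assms by (intro suminf_finite) auto

lemma int_dot_eq_sum:
  assumes "finite A" "{j. k j \<noteq> 0} \<subseteq> A"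
  shows "int_dot k \<theta> = (\<Sum>j\<in>A. real_of_int (k j) * \<theta> j)"
  unfolding int_dot_def using assms by (intro suminf_finite) auto

lemma int_dot_zero [simp]: "int_dot (\<lambda>_. 0) \<theta> = 0"
  by (simp add: int_dot_def)

lemma zero_in_int_vectors [simp]: "(\<lambda>_. 0) \<in> int_vectors \<eta>"
  by (simp add: int_vectors_def)

text \<open>One coordinate of the lattice sum: the value \<open>v = 0\<close> contributes \<open>1\<close> and all other values \<open>O(q)\<close>.\<close>
lemma two_sided_geometric_sum_le:
  fixes q :: real
  assumes "0 \<le> q" "q \<le> 1 / 2"
  shows "(\<Sum>v\<in>{- int m..int m}. q ^ nat \<bar>v\<bar>) \<le> 1 + 4 * q"
proof -
  have "(\<Sum>v\<in>{- int m..int m}. q ^ nat \<bar>v\<bar>) = 1 + 2 * q * (\<Sum>i<m. q ^ i)"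
  proof (induction m)
    case (Suc m)
    have "{- int (Suc m)..int (Suc m)} = insert (- int (Suc m)) (insert (int (Suc m)) {- int m..int m})"
      by auto
    then show ?case using Suc by (simp add: algebra_simps nat_add_distrib)
  qed simp
  also have "(\<Sum>i<m. q ^ i) \<le> (\<Sum>i. q ^ i)"
    using assms by (intro sum_le_suminf summable_geometric) auto
  also have "(\<Sum>i. q ^ i) = 1 / (1 - q)"
    using assms by (intro suminf_geometric) auto
  also have "\<dots> \<le> 2" using assms by (simp add: divide_le_eq)
  finally show ?thesis using assms by (simp add: mult_left_mono)
qed

text \<open>A finite set of integer vectors lies in a box \<open>{-m..m}\<close> in the first \<open>n\<close> coordinates.  The sum over the
box factorizes, and with \<open>q\<^sub>j = exp (-\<langle>j\<rangle>)\<close> the product of the factors \<open>1 + 4 q\<^sub>j\<close> is bounded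
independently of the box because \<open>\<Sum>\<^sub>j q\<^sub>j\<close> converges.\<close>
lemma exp_int_norm_summable:
  assumes "1 \<le> \<eta>"
  shows "(\<lambda>k. exp (- int_norm \<eta> k)) summable_on int_vectors \<eta>"
proof (rule nonneg_bdd_above_summable_on)
  define q where "q = (\<lambda>j. exp (- jbracket j))"
  have e1: "exp (- 1) \<le> (1/2 :: real)"
    using exp_ge_add_one_self[of 1] by (simp add: exp_minus field_simps)
  have q: "0 \<le> q j" "q j \<le> 1 / 2" for j
  proof -
    have "q j \<le> exp (- 1)" using jbracket_ge_1[of j] by (simp add: q_def)
    with e1 show "q j \<le> 1 / 2" by linarith
    show "0 \<le> q j" by (simp add: q_def)
  qed
  have q_summable: "summable q"
  proof (rule summable_comparison_test'[of "\<lambda>j. exp (- 1) ^ j" 0])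
    show "summable (\<lambda>j. exp (- 1) ^ j :: real)" by (rule summable_geometric) simp
    show "norm (q j) \<le> exp (- 1) ^ j" for j
      using jbracket_ge[of j] by (simp add: q_def flip: exp_of_nat_mult)
  qed
  show "bdd_above (sum (\<lambda>k. exp (- int_norm \<eta> k)) ` {S. S \<subseteq> int_vectors \<eta> \<and> finite S})"
  proof (rule bdd_aboveI2)
    fix S assume "S \<in> {S. S \<subseteq> int_vectors \<eta> \<and> finite S}"
    then have S: "S \<subseteq> int_vectors \<eta>" "finite S" by auto
    define U where "U = (\<Union>k\<in>S. {j. k j \<noteq> 0})"
    have "finite U" using S int_vectors_finite_support by (auto simp: U_def)
    then obtain n where n: "U \<subseteq> {..<n}" using finite_nat_iff_bounded by auto
    have "finite (\<Union>k\<in>S. (\<lambda>j. nat \<bar>k j\<bar>) ` {..<n})" using S by auto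
    then obtain m where m: "(\<Union>k\<in>S. (\<lambda>j. nat \<bar>k j\<bar>) ` {..<n}) \<subseteq> {..<m}"
      using finite_nat_iff_bounded by auto
    let ?B = "\<lambda>_. {- int m..int m}"
    let ?r = "\<lambda>k. restrict k {..<n}"
    have inj: "inj_on ?r S"
    proof (rule inj_onI)
      fix k k' assume k: "k \<in> S" "k' \<in> S" "?r k = ?r k'"
      show "k = k'"
      proof
        fix j
        show "k j = k' j"
        proof (cases "j < n")
          case True
          with fun_cong[OF k(3), of j] show ?thesis by simp
        next
          case False
          then have "j \<notin> U" using n by auto
          then have "k j = 0" "k' j = 0" using k(1,2) by (auto simp: U_def)
          then show ?thesis by simp
        qed
      qed
    qed
    have into: "?r ` S \<subseteq> PiE {..<n} ?B"
    proof
      fix g assume "g \<in> ?r ` S"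
      then obtain k where k: "k \<in> S" "g = ?r k" by auto
      have "k j \<in> ?B j" if "j < n" for j
      proof -
        have "nat \<bar>k j\<bar> < m" using m k that by auto
        then show ?thesis by auto
      qed
      then show "g \<in> PiE {..<n} ?B" using k by auto
    qed
    have "(\<Sum>k\<in>S. exp (- int_norm \<eta> k)) \<le> (\<Sum>k\<in>S. \<Prod>j<n. q j ^ nat \<bar>?r k j\<bar>)"
    proof (rule sum_mono)
      fix k assume k: "k \<in> S"
      have "(\<Sum>j<n. jbracket j * real_of_int \<bar>k j\<bar>) \<le> (\<Sum>j<n. jbracket j ^ \<eta> * real_of_int \<bar>k j\<bar>)"
        using assms jbracket_ge_1 by (intro sum_mono mult_right_mono self_le_power) auto
      also have "\<dots> = int_norm \<eta> k"
        using n k by (intro int_norm_eq_sum[symmetric]) (auto simp: U_def)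
      finally have "exp (- int_norm \<eta> k) \<le> exp (\<Sum>j<n. - (jbracket j * real_of_int \<bar>k j\<bar>))"
        by (simp add: sum_negf)
      also have "\<dots> = (\<Prod>j<n. exp (- (jbracket j * real_of_int \<bar>k j\<bar>)))" by (rule exp_sum) simp
      also have "\<dots> = (\<Prod>j<n. q j ^ nat \<bar>?r k j\<bar>)"
        by (intro prod.cong refl) (simp add: q_def mult.commute flip: exp_of_nat_mult)
      finally show "exp (- int_norm \<eta> k) \<le> (\<Prod>j<n. q j ^ nat \<bar>?r k j\<bar>)" .
    qed
    also have "\<dots> = (\<Sum>g\<in>?r ` S. \<Prod>j<n. q j ^ nat \<bar>g j\<bar>)"
      by (subst sum.reindex[OF inj]) simp
    also have "\<dots> \<le> (\<Sum>g\<in>PiE {..<n} ?B. \<Prod>j<n. q j ^ nat \<bar>g j\<bar>)"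
      using into q by (intro sum_mono2 finite_PiE prod_nonneg) auto
    also have "\<dots> = (\<Prod>j<n. \<Sum>v\<in>?B j. q j ^ nat \<bar>v\<bar>)"
      by (subst prod_sum_PiE) auto
    also have "\<dots> \<le> (\<Prod>j<n. exp (4 * q j))"
    proof (rule prod_mono, safe)
      fix j
      show "0 \<le> (\<Sum>v\<in>?B j. q j ^ nat \<bar>v\<bar>)" using q by (intro sum_nonneg) auto
      have "(\<Sum>v\<in>?B j. q j ^ nat \<bar>v\<bar>) \<le> 1 + 4 * q j"
        using q by (rule two_sided_geometric_sum_le)
      also have "\<dots> \<le> exp (4 * q j)" by (rule exp_ge_add_one_self)
      finally show "(\<Sum>v\<in>?B j. q j ^ nat \<bar>v\<bar>) \<le> exp (4 * q j)" .
    qed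
    also have "\<dots> = exp (4 * (\<Sum>j<n. q j))" by (simp add: exp_sum sum_distrib_left)
    also have "\<dots> \<le> exp (4 * (\<Sum>j. q j))"
      using q q_summable by (simp add: sum_le_suminf)
    finally show "(\<Sum>k\<in>S. exp (- int_norm \<eta> k)) \<le> exp (4 * (\<Sum>j. q j))" .
  qed
qed auto

text \<open>Reducing modulo \<open>1\<close> changes the phase by an integer, as an integer vector in the summable class has only
finitely many nonzero entries.\<close>
lemma cis_int_dot_rotation:
  assumes "k \<in> int_vectors \<eta>"
  shows "cis (2 * pi * int_dot k (rotation \<rho> s \<theta>)) = cis (2 * pi * (int_dot k \<theta> + s * int_dot k \<rho>))"
proof -
  let ?A = "{j. k j \<noteq> 0}"
  have dot: "int_dot k \<phi> = (\<Sum>j\<in>?A. real_of_int (k j) * \<phi> j)" for \<phi>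
    by (rule int_dot_eq_sum[OF int_vectors_finite_support[OF assms] order_refl])
  define n where "n = (\<Sum>j\<in>?A. k j * \<lfloor>\<theta> j + s * \<rho> j\<rfloor>)"
  have "int_dot k \<theta> + s * int_dot k \<rho> = int_dot k (rotation \<rho> s \<theta>) + of_int n"
    by (simp add: dot n_def rotation_def frac_def algebra_simps sum_distrib_left sum.distrib sum_subtractf)
  then have "cis (2 * pi * (int_dot k \<theta> + s * int_dot k \<rho>))
      = cis (2 * pi * int_dot k (rotation \<rho> s \<theta>)) * cis (2 * pi * of_int n)"
    by (simp add: cis_mult algebra_simps)
  also have "cis (2 * pi * of_int n) = 1" by (rule cis_multiple_2pi) simp
  finally show ?thesis by simp
qed

lemma one_plus_power_le:
  fixes a :: real
  assumes "0 \<le> a" "1 \<le> n"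
  shows "1 + a ^ n \<le> (1 + a) ^ n"
  using assms(2)
proof (induction n rule: dec_induct)
  case (step n)
  have "1 + a ^ Suc n \<le> (1 + a) ^ n + a * (1 + a) ^ n"
    using assms by (intro add_mono one_le_power) (auto intro!: mult_left_mono power_mono)
  then show ?case by (simp add: algebra_simps)
qed simp

text \<open>With \<open>a = \<langle>j\<rangle>\<^sup>\<mu> \<bar>k\<^sub>j\<bar>\<close>, each factor of the weight is at least
\<open>1 / (1 + a\<^sup>\<mu>) \<ge> 1 / (1 + a)\<^sup>\<mu> \<ge> exp (-\<mu> a)\<close>, and the values \<open>a\<close> add up to the norm.  So the divisors are
only exponentially small in the norm, while the Fourier coefficients are doubly exponentially small.\<close>
lemma exp_le_dioph_weight:
  assumes "1 \<le> \<mu>" and "\<And>i. i \<in> {1..l} \<Longrightarrow> k i \<in> int_vectors \<mu>"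
  shows "exp (- (real \<mu> * (\<Sum>i=1..l. int_norm \<mu> (k i)))) \<le> dioph_weight l \<mu> k"
proof -
  have factor: "exp (- (real \<mu> * int_norm \<mu> \<kappa>)) \<le> (\<Prod>j. inverse (1 + real_of_int \<bar>\<kappa> j\<bar> ^ \<mu> * jbracket j ^ \<mu>))"
    if "\<kappa> \<in> int_vectors \<mu>" for \<kappa>
  proof -
    let ?A = "{j. \<kappa> j \<noteq> 0}"
    have fin: "finite ?A" using that by (rule int_vectors_finite_support)
    have "exp (- (real \<mu> * int_norm \<mu> \<kappa>)) = (\<Prod>j\<in>?A. exp (- (real \<mu> * (jbracket j ^ \<mu> * real_of_int \<bar>\<kappa> j\<bar>))))"
      by (simp add: int_norm_eq_sum[OF fin order_refl] sum_distrib_left sum_negf exp_sum[OF fin, symmetric])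
    also have "\<dots> \<le> (\<Prod>j\<in>?A. inverse (1 + real_of_int \<bar>\<kappa> j\<bar> ^ \<mu> * jbracket j ^ \<mu>))"
    proof (rule prod_mono, safe)
      fix j
      let ?b = "jbracket j" and ?v = "real_of_int \<bar>\<kappa> j\<bar>"
      have b: "1 \<le> ?b" by (rule jbracket_ge_1)
      have "1 + ?v ^ \<mu> * ?b ^ \<mu> = 1 + (?v * ?b) ^ \<mu>" by (simp add: power_mult_distrib)
      also have "\<dots> \<le> 1 + (?b ^ \<mu> * ?v) ^ \<mu>"

        using b assms mult_right_mono[OF self_le_power[of ?b \<mu>], of ?v]
        by (intro add_left_mono power_mono) (simp_all add: mult.commute)
      also have "\<dots> \<le> (1 + ?b ^ \<mu> * ?v) ^ \<mu>" using b assms by (intro one_plus_power_le) auto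
      also have "\<dots> \<le> exp (?b ^ \<mu> * ?v) ^ \<mu>"
        using b by (intro power_mono exp_ge_add_one_self) auto
      also have "\<dots> = exp (real \<mu> * (?b ^ \<mu> * ?v))" by (simp add: exp_of_nat_mult)
      finally have "1 + ?v ^ \<mu> * ?b ^ \<mu> \<le> exp (real \<mu> * (?b ^ \<mu> * ?v))" .
      moreover have "0 < 1 + ?v ^ \<mu> * ?b ^ \<mu>" using b by (intro add_pos_nonneg) auto
      ultimately show "exp (- (real \<mu> * (?b ^ \<mu> * ?v))) \<le> inverse (1 + ?v ^ \<mu> * ?b ^ \<mu>)"
        unfolding exp_minus by (rule le_imp_inverse_le)
    qed auto
    also have "\<dots> = (\<Prod>j. inverse (1 + real_of_int \<bar>\<kappa> j\<bar> ^ \<mu> * jbracket j ^ \<mu>))"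
      using assms fin by (intro prodinf_finite[symmetric]) auto
    finally show ?thesis .
  qed
  have "exp (- (real \<mu> * (\<Sum>i=1..l. int_norm \<mu> (k i)))) = (\<Prod>i=1..l. exp (- (real \<mu> * int_norm \<mu> (k i))))"
    by (simp add: sum_distrib_left sum_negf flip: exp_sum)
  also have "\<dots> \<le> dioph_weight l \<mu> k"
    unfolding dioph_weight_def using assms by (intro prod_mono conjI factor) auto
  finally show ?thesis .
qed

section \<open>Ordered products of Banach-algebra-valued series\<close>

lemma bounded_bilinear_algebra_mult:
  "bounded_bilinear ((*) :: 'b \<Rightarrow> 'b \<Rightarrow> 'b::complex_banach_algebra)"
proof
  obtain K where "\<forall>x y :: 'b. norm (x * y) \<le> K * norm x * norm y" using mult_bounded by blast
  then show "\<exists>K. \<forall>x y :: 'b. norm (x * y) \<le> norm x * norm y * K" by (auto simp: mult_ac intro!: exI[of _ K])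
qed (auto simp: algebra_simps)

lemma one_scaleC [simp]: "1 *\<^sub>C x = x"
  using scaleC_of_real[of 1 x] by simp

lemma bounded_linear_scaleC_left: "bounded_linear (\<lambda>z. z *\<^sub>C (x :: 'b::complex_banach_algebra))"
proof
  show "\<exists>K. \<forall>z. norm (z *\<^sub>C x) \<le> norm z * K"
    by (auto simp: norm_scaleC intro!: exI[of _ "norm x"])
qed (auto simp: scaleC_add_left scaleC_scaleC scaleR_conv_of_real simp flip: scaleC_of_real)

lemma ordered_prod_1 [simp]: "ordered_prod (Suc 0) f = f 1"
  by (simp add: ordered_prod_def)

lemma ordered_prod_Suc: "1 \<le> l \<Longrightarrow> ordered_prod (Suc l) f = ordered_prod l f * f (Suc l)"
  by (simp add: ordered_prod_def)

lemma ordered_prod_cong: "1 \<le> l \<Longrightarrow> (\<And>i. i \<in> {1..l} \<Longrightarrow> f i = g i) \<Longrightarrow> ordered_prod l f = ordered_prod l g"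
  by (induction l rule: dec_induct) (auto simp: ordered_prod_Suc)

lemma ordered_prod_scaleC:
  fixes f :: "nat \<Rightarrow> 'b::complex_banach_algebra"
  assumes "1 \<le> l"
  shows "ordered_prod l (\<lambda>i. c i *\<^sub>C f i) = (\<Prod>i=1..l. c i) *\<^sub>C ordered_prod l f"
  using assms
  by (induction l rule: dec_induct)
    (auto simp: ordered_prod_Suc mult_scaleC_left' mult_scaleC_right' scaleC_scaleC mult.commute)

lemma norm_ordered_prod_le:
  fixes f :: "nat \<Rightarrow> 'b::complex_banach_algebra"
  assumes "\<And>x y :: 'b. norm (x * y) \<le> norm x * norm y * K" "0 \<le> K" "1 \<le> l"
  shows "norm (ordered_prod l f) \<le> K ^ (l - 1) * (\<Prod>i=1..l. norm (f i))"
  using assms(3)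
proof (induction l rule: dec_induct)
  case (step l)
  have "norm (ordered_prod (Suc l) f) \<le> norm (ordered_prod l f) * norm (f (Suc l)) * K"
    using step assms by (simp add: ordered_prod_Suc)
  also have "\<dots> \<le> (K ^ (l - 1) * (\<Prod>i=1..l. norm (f i))) * norm (f (Suc l)) * K"
    using step assms by (intro mult_right_mono) auto
  also have "\<dots> = K ^ (Suc l - 1) * (\<Prod>i=1..Suc l. norm (f i))"
    using step by (simp add: mult_ac power_eq_if)
  finally show ?case .
qed simp

lemma summable_on_times:
  fixes f :: "'a \<Rightarrow> real" and g :: "'c \<Rightarrow> real"
  assumes "f summable_on A" "g summable_on B" "\<And>x. 0 \<le> f x" "\<And>x. 0 \<le> g x"
  shows "(\<lambda>(a, b). f a * g b) summable_on A \<times> B"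
proof -
  have "(\<lambda>p. norm (case p of (a, b) \<Rightarrow> f a * g b)) summable_on A \<times> B"
    unfolding Infinite_Sum.abs_summable_on_Sigma_iff
    using assms by (simp add: infsum_cmult_right' infsum_nonneg summable_on_cmult_left summable_on_cmult_right)
  then show ?thesis by (rule abs_summable_summable)
qed

lemma summable_on_prod_PiE:
  fixes g :: "'i \<Rightarrow> 'a \<Rightarrow> real"
  assumes "finite I" "\<And>i. i \<in> I \<Longrightarrow> g i summable_on B i" "\<And>i x. 0 \<le> g i x"
  shows "(\<lambda>\<kappa>. \<Prod>i\<in>I. g i (\<kappa> i)) summable_on PiE I B"
  using assms(1,2)
proof (induction I)
  case empty
  then show ?case by simp
next
  case (insert i I)
  have "(\<lambda>(a, \<kappa>). g i a * (\<Prod>i\<in>I. g i (\<kappa> i))) summable_on B i \<times> PiE I B"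
    using insert assms(3) by (intro summable_on_times prod_nonneg) auto
  also have "?this \<longleftrightarrow> ((\<lambda>\<kappa>. \<Prod>i\<in>insert i I. g i (\<kappa> i)) \<circ> (\<lambda>(y, g). g(i := y))) summable_on B i \<times> PiE I B"
  proof (rule summable_on_cong)
    fix p assume "p \<in> B i \<times> PiE I B"
    have "(\<Prod>j\<in>I. g j (((snd p)(i := fst p)) j)) = (\<Prod>j\<in>I. g j (snd p j))"
      using insert by (intro prod.cong) auto
    then show "(case p of (a, \<kappa>) \<Rightarrow> g i a * (\<Prod>i\<in>I. g i (\<kappa> i))) =
         ((\<lambda>\<kappa>. \<Prod>i\<in>insert i I. g i (\<kappa> i)) \<circ> (\<lambda>(y, g). g(i := y))) p"
      using insert by (simp add: case_prod_beta)
  qed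
  also have "\<dots> \<longleftrightarrow> ?case"
    unfolding PiE_insert_eq
    by (rule summable_on_reindex[symmetric]) (rule inj_combinator[OF insert(2)])
  finally show ?case .
qed

text \<open>The order of the index pair follows \<open>PiE_insert_eq\<close>, which puts the new component first, whereas
the new factor stands on the right of the (possibly noncommutative) product.\<close>
lemma has_sum_mult:
  fixes f :: "'i \<Rightarrow> 'b::complex_banach_algebra" and g :: "'j \<Rightarrow> 'b"
  assumes f: "(f has_sum x) A" "(\<lambda>a. norm (f a)) summable_on A"
    and g: "(g has_sum y) B" "(\<lambda>b. norm (g b)) summable_on B"
  shows "((\<lambda>(b, a). f a * g b) has_sum x * y) (B \<times> A)"
proof (rule has_sum_SigmaI)
  interpret bounded_bilinear "(*) :: 'b \<Rightarrow> 'b \<Rightarrow> 'b" by (rule bounded_bilinear_algebra_mult)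
  show "((\<lambda>a. case (b, a) of (b, a) \<Rightarrow> f a * g b) has_sum x * g b) A" for b
    using has_sum_bounded_linear[OF bounded_linear_left f(1)] by (simp add: o_def)
  show "((\<lambda>b. x * g b) has_sum x * y) B"
    using has_sum_bounded_linear[OF bounded_linear_right g(1)] by (simp add: o_def)
  obtain K where K: "\<And>x y :: 'b. norm (x * y) \<le> norm x * norm y * K" "0 \<le> K"
    using nonneg_bounded by auto
  have "(\<lambda>(b, a). norm (g b) * norm (f a)) summable_on B \<times> A"
    by (rule summable_on_times) (use f g in auto)
  then have "(\<lambda>p. (case p of (b, a) \<Rightarrow> norm (g b) * norm (f a)) * K) summable_on B \<times> A"
    by (rule summable_on_cmult_left)
  then have "(\<lambda>p. norm (case p of (b, a) \<Rightarrow> f a * g b)) summable_on B \<times> A"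
    by (rule Infinite_Sum.abs_summable_on_comparison_test') (use K in \<open>auto simp: mult.commute\<close>)
  then show "(\<lambda>(b, a). f a * g b) summable_on B \<times> A"
    by (rule abs_summable_summable)
qed

lemma ordered_prod_summable:
  fixes f :: "nat \<Rightarrow> 'i \<Rightarrow> 'b::complex_banach_algebra"
  assumes "1 \<le> l" "\<And>i. i \<in> {1..l} \<Longrightarrow> (\<lambda>k. norm (f i k)) summable_on B"
  shows "(\<lambda>\<kappa>. norm (ordered_prod l (\<lambda>i. f i (\<kappa> i)))) summable_on PiE {1..l} (\<lambda>_. B)"
proof -
  obtain K where K: "\<And>x y :: 'b. norm (x * y) \<le> norm x * norm y * K" "0 \<le> K"
    using bounded_bilinear.nonneg_bounded[OF bounded_bilinear_algebra_mult] by auto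
  have "(\<lambda>\<kappa>. K ^ (l - 1) * (\<Prod>i=1..l. norm (f i (\<kappa> i)))) summable_on PiE {1..l} (\<lambda>_. B)"
    using assms by (intro summable_on_cmult_right summable_on_prod_PiE) auto
  then show ?thesis
    by (rule Infinite_Sum.abs_summable_on_comparison_test') (rule norm_ordered_prod_le[OF K assms(1)])
qed

text \<open>Multiplying out the factors one after the other; absolute summability justifies each rearrangement.\<close>
lemma ordered_prod_has_sum:
  fixes f :: "nat \<Rightarrow> 'i \<Rightarrow> 'b::complex_banach_algebra"
  assumes "1 \<le> l" "\<And>i. i \<in> {1..l} \<Longrightarrow> (f i has_sum x i) B"
    "\<And>i. i \<in> {1..l} \<Longrightarrow> (\<lambda>k. norm (f i k)) summable_on B"
  shows "((\<lambda>\<kappa>. ordered_prod l (\<lambda>i. f i (\<kappa> i))) has_sum ordered_prod l x) (PiE {1..l} (\<lambda>_. B))"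
  using assms
proof (induction l rule: dec_induct)
  case base
  let ?h = "\<lambda>k. (\<lambda>i\<in>{1::nat}. k)"
  have I: "PiE {1..1} (\<lambda>_. B) = ?h ` B"
    unfolding atLeastAtMost_singleton PiE_over_singleton_iff by blast
  have inj: "inj_on ?h B"
  proof (rule inj_onI)
    fix k k' assume "?h k = ?h k'"
    from fun_cong[OF this, of 1] show "k = k'" by simp
  qed
  have "((\<lambda>k. ordered_prod 1 (\<lambda>i. f i (?h k i))) has_sum ordered_prod 1 x) B"
    using base by simp
  then show ?case
    unfolding I has_sum_reindex[OF inj] by (simp add: o_def)
next
  case (step l)
  have I: "{1..Suc l} = insert (Suc l) {1..l}" by auto
  let ?P = "\<lambda>\<kappa>. ordered_prod l (\<lambda>i. f i (\<kappa> i))"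
  let ?h = "\<lambda>(y, g). g(Suc l := y)"
  have "((\<lambda>(k, \<kappa>). ?P \<kappa> * f (Suc l) k) has_sum ordered_prod l x * x (Suc l)) (B \<times> PiE {1..l} (\<lambda>_. B))"
    using step by (intro has_sum_mult ordered_prod_summable) auto
  also have "?this \<longleftrightarrow> (((\<lambda>\<kappa>. ordered_prod (Suc l) (\<lambda>i. f i (\<kappa> i))) \<circ> ?h) has_sum ordered_prod l x * x (Suc l))
      (B \<times> PiE {1..l} (\<lambda>_. B))"
  proof (rule has_sum_cong)
    fix p assume "p \<in> B \<times> PiE {1..l} (\<lambda>_. B)"
    have "ordered_prod l (\<lambda>i. f i (((snd p)(Suc l := fst p)) i)) = ?P (snd p)"
      using step by (intro ordered_prod_cong) auto
    then show "(case p of (k, \<kappa>) \<Rightarrow> ?P \<kappa> * f (Suc l) k) =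
        ((\<lambda>\<kappa>. ordered_prod (Suc l) (\<lambda>i. f i (\<kappa> i))) \<circ> ?h) p"
      using step by (simp add: case_prod_beta ordered_prod_Suc)
  qed
  also have "\<dots> \<longleftrightarrow> ?case"
    unfolding I PiE_insert_eq
    using step(1) by (subst has_sum_reindex[OF inj_combinator]) (simp_all add: ordered_prod_Suc)
  finally show ?case .
qed

section \<open>Weighted means of trigonometric series\<close>

lemma has_sum_finite_sum:
  fixes f :: "'n \<Rightarrow> 'i \<Rightarrow> 'b::topological_comm_monoid_add"
  assumes "finite I" "\<And>n. n \<in> I \<Longrightarrow> (f n has_sum S n) A"
  shows "((\<lambda>k. \<Sum>n\<in>I. f n k) has_sum (\<Sum>n\<in>I. S n)) A"
  using assms by (induction I) (auto intro: has_sum_add has_sum_0)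

definition discrete_mean :: "nat \<Rightarrow> (real \<Rightarrow> 'a::real_normed_vector) \<Rightarrow> 'a" where
  "discrete_mean N g = (1 / (\<Sum>s<N. weight (real s / real N))) *\<^sub>R
     (\<Sum>n<N. weight (real n / real N) *\<^sub>R g (real n))"

definition continuous_mean :: "real \<Rightarrow> (real \<Rightarrow> 'a::real_normed_vector) \<Rightarrow> 'a" where
  "continuous_mean T g = (1 / T) *\<^sub>R integral {0..T} (\<lambda>s. weight (s / T) *\<^sub>R g s)"

lemma weight_nonneg: "0 \<le> weight x"
  using integral_cutoff_pos cutoff_nonneg by (simp add: weight_eq_cutoff)

lemma continuous_on_weight: "continuous_on A weight"
  unfolding weight_eq_cutoff by (intro continuous_intros continuous_on_cutoff) (use integral_cutoff_pos in simp)

lemma integral_weight: "integral {0..1} weight = 1"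
  unfolding weight_eq_cutoff using integral_cutoff_pos by simp

lemma scaleR_scaleC: "r *\<^sub>R (z *\<^sub>C x) = (r *\<^sub>R z) *\<^sub>C x"
  by (simp add: scaleR_conv_of_real scaleC_scaleC flip: scaleC_of_real)

lemma scaleC_sum_left: "(\<Sum>n\<in>I. z n) *\<^sub>C (x::'b::complex_banach_algebra) = (\<Sum>n\<in>I. z n *\<^sub>C x)"
  using linear_sum[OF bounded_linear.linear[OF bounded_linear_scaleC_left]] by blast

lemma discrete_mean_has_sum:
  fixes c :: "'i \<Rightarrow> 'b::complex_banach_algebra"
  assumes "\<And>s. ((\<lambda>k. e k s *\<^sub>C c k) has_sum g s) J"
  shows "((\<lambda>k. discrete_mean N (e k) *\<^sub>C c k) has_sum discrete_mean N g) J"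
proof -
  have "((\<lambda>k. (1 / (\<Sum>s<N. weight (real s / real N))) *\<^sub>R
     (\<Sum>n<N. weight (real n / real N) *\<^sub>R (e k (real n) *\<^sub>C c k))) has_sum discrete_mean N g) J"
    unfolding discrete_mean_def by (intro has_sum_scaleR has_sum_finite_sum assms) auto
  then show ?thesis
    by (simp add: discrete_mean_def scaleR_scaleC flip: scaleC_sum_left)
qed

text \<open>The series converges uniformly in \<open>s\<close> by the Weierstrass M-test, so it may be integrated term by term.\<close>
lemma continuous_mean_has_sum:
  fixes c :: "'i \<Rightarrow> 'b::complex_banach_algebra"
  assumes sum: "\<And>s. ((\<lambda>k. e k s *\<^sub>C c k) has_sum g s) J"
    and c: "(\<lambda>k. norm (c k)) summable_on J"
    and e: "\<And>k s. cmod (e k s) \<le> 1" "\<And>k. continuous_on UNIV (e k)"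
  shows "((\<lambda>k. continuous_mean T (e k) *\<^sub>C c k) has_sum continuous_mean T g) J"
proof -
  let ?w = "\<lambda>s. weight (s / T)"
  have contw: "continuous_on A ?w" for A
  proof -
    have "continuous_on A (\<lambda>s. s / T)" by (cases "T = 0") (auto intro!: continuous_intros)
    then show ?thesis by (rule continuous_on_compose2[OF continuous_on_weight[of UNIV]]) auto
  qed
  have cont: "continuous_on {0..T} (\<lambda>s. ?w s *\<^sub>R e k s)" for k
    by (intro continuous_intros contw continuous_on_subset[OF e(2)]) auto
  have cont': "continuous_on {0..T} (\<lambda>s. ?w s *\<^sub>R (e k s *\<^sub>C c k))" for k
    unfolding scaleR_scaleC
    by (rule bounded_linear.continuous_on[OF bounded_linear_scaleC_left cont])
  obtain W where W: "\<And>x. x \<in> {0..T} \<Longrightarrow> \<bar>?w x\<bar> \<le> W"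
    using compact_imp_bounded[OF compact_continuous_image[OF contw compact_Icc], of 0 T]
    by (fastforce simp: bounded_iff)
  have "uniform_limit {0..T} (\<lambda>X s. \<Sum>k\<in>X. ?w s *\<^sub>R (e k s *\<^sub>C c k)) (\<lambda>s. ?w s *\<^sub>R g s) (finite_subsets_at_top J)"
  proof (rule Weierstrass_m_test_general')
    show "(\<lambda>k. W * norm (c k)) summable_on J" using c by (rule summable_on_cmult_right)
    show "((\<lambda>k. ?w s *\<^sub>R (e k s *\<^sub>C c k)) has_sum ?w s *\<^sub>R g s) J" for s
      by (rule has_sum_scaleR[OF sum])
    fix k s assume "s \<in> {0..T}"
    then have "\<bar>?w s\<bar> * (cmod (e k s) * norm (c k)) \<le> W * (1 * norm (c k))"
      using W[of s] e(1)[of k s] by (intro mult_mono) auto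
    then show "norm (?w s *\<^sub>R (e k s *\<^sub>C c k)) \<le> W * norm (c k)" by (simp add: norm_scaleC)
  qed
  moreover have "continuous_on {0..T} (\<lambda>s. \<Sum>k\<in>X. ?w s *\<^sub>R (e k s *\<^sub>C c k))" for X
    by (intro continuous_on_sum cont')
  ultimately obtain I L where I: "\<And>X. ((\<lambda>s. \<Sum>k\<in>X. ?w s *\<^sub>R (e k s *\<^sub>C c k)) has_integral I X) {0..T}"
    and L: "((\<lambda>s. ?w s *\<^sub>R g s) has_integral L) {0..T}" and IL: "(I \<longlongrightarrow> L) (finite_subsets_at_top J)"
    by (rule uniform_limit_integral) (simp, blast)
  have "I X = (\<Sum>k\<in>X. integral {0..T} (\<lambda>s. ?w s *\<^sub>R e k s) *\<^sub>C c k)" if "finite X" for X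
  proof (rule has_integral_unique[OF I has_integral_sum[OF that]])
    fix k
    show "((\<lambda>s. ?w s *\<^sub>R (e k s *\<^sub>C c k)) has_integral integral {0..T} (\<lambda>s. ?w s *\<^sub>R e k s) *\<^sub>C c k) {0..T}"
      using has_integral_linear[OF integrable_integral[OF integrable_continuous_interval[OF cont]]
          bounded_linear_scaleC_left]
      by (simp add: scaleR_scaleC o_def)
  qed
  then have "((\<lambda>k. integral {0..T} (\<lambda>s. ?w s *\<^sub>R e k s) *\<^sub>C c k) has_sum L) J"
    unfolding has_sum_def
    by (intro Lim_transform_eventually[OF IL] eventually_finite_subsets_at_top_weakI)
  from has_sum_scaleR[OF this, of "1 / T"] show ?thesis
    using integral_unique[OF L] by (simp add: continuous_mean_def scaleR_scaleC)
qed

text \<open>The distance of an averaged series from its resonant term \<open>k0\<close>, when all other terms share a small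
factor \<open>\<epsilon>\<close>.\<close>
lemma norm_has_sum_diff_le:
  fixes c :: "'i \<Rightarrow> 'b::complex_banach_algebra"
  assumes "((\<lambda>k. m k *\<^sub>C c k) has_sum G) J" "k0 \<in> J" "m k0 = 1"
    and "\<And>k. k \<in> J \<Longrightarrow> k \<noteq> k0 \<Longrightarrow> norm (m k *\<^sub>C c k) \<le> \<epsilon> * M k"
    and "M summable_on J" "\<And>k. 0 \<le> M k" "0 \<le> \<epsilon>"
  shows "norm (G - c k0) \<le> \<epsilon> * infsum M J"
proof (rule norm_infsum_le)
  have "((\<lambda>k. if k = k0 then c k0 else 0) has_sum c k0) J"
    using assms(2) by (intro has_sum_finite_neutralI[of "{k0}"]) auto
  then have "((\<lambda>k. - (if k = k0 then c k0 else 0)) has_sum - c k0) J"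
    by (simp only: has_sum_uminus minus_minus)
  from has_sum_add[OF assms(1) this]
  show "((\<lambda>k. m k *\<^sub>C c k - (if k = k0 then c k0 else 0)) has_sum G - c k0) J"
    by simp
  show "((\<lambda>k. \<epsilon> * M k) has_sum \<epsilon> * infsum M J) J"
    using assms(5) by (intro has_sum_cmult_right has_sum_infsum)
qed (use assms in auto)

text \<open>The single term at \<open>N div 2\<close> is already bounded below.  The loss of a factor \<open>N\<close> in comparison with
the true size of the sum is harmless against the exponential decay of the numerator.\<close>
lemma sum_cutoff_ge:
  assumes "2 \<le> N"
  shows "exp (- 16) \<le> (\<Sum>s<N. cutoff (real s / real N))"
proof -
  have "exp (- 16) \<le> cutoff (real (N div 2) / real N)"
  proof (rule cutoff_ge_middle)
    have "N \<le> 4 * (N div 2)" "4 * (N div 2) \<le> 3 * N" using assms by presburger+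
    then have "real N \<le> real (4 * (N div 2))" "real (4 * (N div 2)) \<le> real (3 * N)"
      by (blast intro: of_nat_mono)+
    then show "1/4 \<le> real (N div 2) / real N" "real (N div 2) / real N \<le> 3/4"
      using assms by (auto simp: field_simps)
  qed
  also have "\<dots> \<le> (\<Sum>s<N. cutoff (real s / real N))"
    using assms cutoff_nonneg by (intro member_le_sum) auto
  finally show ?thesis .
qed

lemma discrete_mean_character_le:
  obtains C where "0 < C" "\<And>N \<delta> \<alpha>. 2 \<le> N \<Longrightarrow> 0 < \<delta> \<Longrightarrow> (\<And>n::int. \<delta> \<le> \<bar>\<alpha> - of_int n\<bar>) \<Longrightarrow>
     cmod (discrete_mean N (\<lambda>s. cis (2 * pi * (s * \<alpha>)))) \<le> C * real N * exp (- ((real N * \<delta>) powr (1/4)))"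
proof -
  obtain C :: real where C: "C > 0" "\<And>X P y. 0 < y \<Longrightarrow> 0 \<le> P \<Longrightarrow>
      (\<And>m::nat. X \<le> P * ((1 + real m) * ((2 * real m + 2) ^ 3 / y) ^ m)) \<Longrightarrow> X \<le> P * (C * exp (- (y powr (1/4))))"
    by (rule stretched_exponential_from_all_orders) blast
  let ?c = "exp (- 16) :: real" and ?I = "integral {0..1} cutoff"
  show ?thesis
  proof (rule that[of "C / ?c"])
    fix N :: nat and \<delta> \<alpha> :: real
    assume N: "2 \<le> N" and \<delta>: "0 < \<delta>" and dist: "\<And>n::int. \<delta> \<le> \<bar>\<alpha> - of_int n\<bar>"
    let ?z = "cis (2 * pi * \<alpha>)" and ?S = "\<Sum>n<N. of_real (cutoff (real n / real N)) * cis (2 * pi * \<alpha>) ^ n"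
    have z: "\<delta> \<le> cmod (1 - ?z)" using dist by (rule cmod_one_minus_cis_ge)
    have "cmod ?S \<le> real N * (C * exp (- ((real N * cmod (1 - ?z)) powr (1/4))))"
    proof (rule C(2))
      show "0 < real N * cmod (1 - ?z)" using z \<delta> N by (intro mult_pos_pos) linarith+
      show "cmod ?S \<le> real N * ((1 + real m) * ((2 * real m + 2) ^ 3 / (real N * cmod (1 - ?z))) ^ m)" for m
        by (rule norm_cutoff_exponential_sum_le) (use N z \<delta> in auto)
    qed simp
    also have "\<dots> \<le> real N * (C * exp (- ((real N * \<delta>) powr (1/4))))"
      using z \<delta> C(1) by (auto intro!: mult_left_mono powr_mono2)
    finally have S: "cmod ?S \<le> real N * (C * exp (- ((real N * \<delta>) powr (1/4))))" .
    let ?A = "\<Sum>s<N. cutoff (real s / real N)"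
    have A: "?c \<le> ?A" using N by (rule sum_cutoff_ge)
    have "cis (2 * pi * (real n * \<alpha>)) = ?z ^ n" for n
      by (simp add: Complex.DeMoivre mult_ac)
    then have "discrete_mean N (\<lambda>s. cis (2 * pi * (s * \<alpha>))) = (1 / (?A / ?I)) *\<^sub>R (?S / of_real ?I)"
      unfolding discrete_mean_def weight_eq_cutoff sum_divide_distrib
      by (simp add: scaleR_conv_of_real sum_divide_distrib)
    also have "\<dots> = ?S / of_real ?A"
      using integral_cutoff_pos by (simp add: scaleR_conv_of_real)
    finally have "cmod (discrete_mean N (\<lambda>s. cis (2 * pi * (s * \<alpha>)))) = cmod ?S / ?A"
      using A less_le_trans[OF exp_gt_zero A] by (simp add: norm_divide del: of_real_sum)
    also have "\<dots> \<le> (real N * (C * exp (- ((real N * \<delta>) powr (1/4))))) / ?c"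
      using S A C by (intro frac_le) auto
    finally show "cmod (discrete_mean N (\<lambda>s. cis (2 * pi * (s * \<alpha>))))
       \<le> C / ?c * real N * exp (- ((real N * \<delta>) powr (1/4)))"
      by (simp add: mult_ac)
  qed (use C in auto)
qed

lemma continuous_mean_eq:
  assumes "0 < T" "continuous_on UNIV g"
  shows "continuous_mean T (g :: real \<Rightarrow> complex) = integral {0..1} (\<lambda>x. weight x *\<^sub>R g (T * x))"
proof -
  have "continuous_on {0..1} (\<lambda>x. weight x *\<^sub>R g (T * x))"
    by (intro continuous_intros continuous_on_weight continuous_on_compose2[OF assms(2)]) auto
  then have "((\<lambda>x. weight x *\<^sub>R g (T * x)) has_integral integral {0..1} (\<lambda>x. weight x *\<^sub>R g (T * x))) (cbox 0 1)"
    by (simp add: integrable_integral integrable_continuous_interval)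
  from has_integral_affinity'[OF this, of "1 / T" 0] show ?thesis
    using assms(1) by (simp add: continuous_mean_def has_integral_iff scaleR_conv_of_real)
qed

lemma continuous_mean_character_le:
  obtains C where "0 < C" "\<And>T \<delta> \<alpha>. 0 < T \<Longrightarrow> 0 < \<delta> \<Longrightarrow> \<delta> \<le> \<bar>\<alpha>\<bar> \<Longrightarrow>
     cmod (continuous_mean T (\<lambda>s. cis (2 * pi * (s * \<alpha>)))) \<le> C * exp (- ((T * \<delta>) powr (1/4)))"
proof -
  obtain C :: real where C: "C > 0" "\<And>X P y. 0 < y \<Longrightarrow> 0 \<le> P \<Longrightarrow>
      (\<And>m::nat. X \<le> P * ((1 + real m) * ((2 * real m + 2) ^ 3 / y) ^ m)) \<Longrightarrow> X \<le> P * (C * exp (- (y powr (1/4))))"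
    by (rule stretched_exponential_from_all_orders) blast
  let ?I = "integral {0..1} cutoff"
  show ?thesis
  proof (rule that[of "C / ?I"])
    fix T \<delta> \<alpha> :: real
    assume T: "0 < T" and \<delta>: "0 < \<delta>" and \<alpha>: "\<delta> \<le> \<bar>\<alpha>\<bar>"
    let ?\<beta> = "2 * pi * T * \<alpha>"
    let ?F = "integral {0..1} (\<lambda>x. of_real (cutoff x) * cis (?\<beta> * x))"
    have "T * \<delta> \<le> 2 * pi * (T * \<bar>\<alpha>\<bar>)"
      using T \<delta> \<alpha> pi_gt3 mult_mono[of 1 "2 * pi" "T * \<delta>" "T * \<bar>\<alpha>\<bar>"] by simp
    then have \<beta>: "T * \<delta> \<le> \<bar>?\<beta>\<bar>" using T by (simp add: abs_mult mult_ac)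
    have pos: "0 < \<bar>?\<beta>\<bar>" using mult_pos_pos[OF T \<delta>] \<beta> by (rule less_le_trans)
    have "cmod ?F \<le> 1 * (C * exp (- (\<bar>?\<beta>\<bar> powr (1/4))))"
    proof (rule C(2)[OF pos])
      fix m
      let ?q = "((2 * real m + 2) ^ 3 / \<bar>?\<beta>\<bar>) ^ m"
      have "cmod ?F \<le> ?q" using pos by (intro cmod_cutoff_fourier_integral_le) auto
      also have "\<dots> \<le> (1 + real m) * ?q" using mult_right_mono[of 1 "1 + real m" ?q] by simp
      finally show "cmod ?F \<le> 1 * ((1 + real m) * ?q)" by simp
    qed simp
    also have "\<dots> \<le> C * exp (- ((T * \<delta>) powr (1/4)))"
      using \<beta> T \<delta> C(1) by (auto intro!: powr_mono2)
    finally have F: "cmod ?F \<le> C * exp (- ((T * \<delta>) powr (1/4)))" .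
    have "continuous_mean T (\<lambda>s. cis (2 * pi * (s * \<alpha>)))
        = integral {0..1} (\<lambda>x. weight x *\<^sub>R cis (2 * pi * (T * x * \<alpha>)))"
      using T by (intro continuous_mean_eq) (auto intro!: continuous_intros)
    also have "\<dots> = integral {0..1} (\<lambda>x. (of_real (cutoff x) * cis (?\<beta> * x)) / of_real ?I)"
      by (intro integral_cong) (simp add: weight_eq_cutoff scaleR_conv_of_real mult_ac)
    also have "\<dots> = ?F / of_real ?I" by simp
    finally have "cmod (continuous_mean T (\<lambda>s. cis (2 * pi * (s * \<alpha>)))) = cmod ?F / ?I"
      using integral_cutoff_pos by (simp add: norm_divide)
    also have "\<dots> \<le> C * exp (- ((T * \<delta>) powr (1/4))) / ?I"
      using F integral_cutoff_pos by (intro divide_right_mono) auto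
    finally show "cmod (continuous_mean T (\<lambda>s. cis (2 * pi * (s * \<alpha>))))
        \<le> C / ?I * exp (- ((T * \<delta>) powr (1/4)))" by simp
  qed (use C integral_cutoff_pos in auto)
qed

lemma discrete_mean_mult: "discrete_mean N (\<lambda>s. z * f s) = z * (discrete_mean N f :: complex)"
  by (simp add: discrete_mean_def sum_distrib_left scaleR_conv_of_real mult_ac)

lemma continuous_mean_mult: "continuous_mean T (\<lambda>s. z * f s) = z * (continuous_mean T f :: complex)"
  by (simp add: continuous_mean_def mult_scaleR_right [symmetric] del: mult_scaleR_right)

lemma sum_weight_pos: "2 \<le> N \<Longrightarrow> 0 < (\<Sum>s<N. weight (real s / real N))"
  using less_le_trans[OF exp_gt_zero sum_cutoff_ge[of N]] integral_cutoff_pos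
  by (simp add: weight_eq_cutoff flip: sum_divide_distrib)

lemma discrete_mean_one: "2 \<le> N \<Longrightarrow> discrete_mean N (\<lambda>_. 1) = (1 :: complex)"
  using sum_weight_pos[of N] by (simp add: discrete_mean_def flip: of_real_sum scaleR_sum_left)

lemma continuous_mean_one: "0 < T \<Longrightarrow> continuous_mean T (\<lambda>_. 1) = (1 :: complex)"
  using integral_weight integral_linear[OF integrable_continuous_interval[OF continuous_on_weight] bounded_linear_of_real, of 0 1]
  by (simp add: continuous_mean_eq continuous_intros scaleR_conv_of_real o_def)

lemma cmod_discrete_mean_le_1:
  assumes "2 \<le> N" "\<And>s. cmod (f s) \<le> 1"
  shows "cmod (discrete_mean N f) \<le> 1"
proof -
  have "cmod (\<Sum>n<N. weight (real n / real N) *\<^sub>R f (real n)) \<le> (\<Sum>n<N. weight (real n / real N))"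
  proof (rule sum_norm_le)
    fix n show "cmod (weight (real n / real N) *\<^sub>R f (real n)) \<le> weight (real n / real N)"
      using assms(2)[of "real n"] weight_nonneg[of "real n / real N"] mult_left_mono[of "cmod (f (real n))" 1 "weight (real n / real N)"]
      by simp
  qed
  then show ?thesis using sum_weight_pos[OF assms(1)] by (simp add: discrete_mean_def divide_le_eq)
qed

lemma cmod_continuous_mean_le_1:
  assumes "0 < T" "\<And>s. cmod (f s) \<le> 1" "continuous_on UNIV f"
  shows "cmod (continuous_mean T f) \<le> 1"
proof -
  have cont: "continuous_on {0..1} (\<lambda>x. weight x *\<^sub>R f (T * x))"
    by (intro continuous_intros continuous_on_weight continuous_on_compose2[OF assms(3)]) auto
  have "cmod (integral {0..1} (\<lambda>x. weight x *\<^sub>R f (T * x))) \<le> integral {0..1} weight"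
  proof (rule integral_norm_bound_integral)
    fix x show "cmod (weight x *\<^sub>R f (T * x)) \<le> weight x"
      using assms(2)[of "T * x"] weight_nonneg[of x] mult_left_mono[of "cmod (f (T * x))" 1 "weight x"] by simp
  qed (intro integrable_continuous_interval cont continuous_on_weight)+
  then show ?thesis by (simp add: continuous_mean_eq[OF assms(1,3)] integral_weight)
qed

section \<open>Coefficient decay against small divisors\<close>

text \<open>The two regimes are separated by \<open>exp (\<mu> x) = T\<^sup>1\<^sup>/\<^sup>2\<close>, which leaves a divisor of size at least
\<open>\<gamma> T\<^sup>-\<^sup>1\<^sup>/\<^sup>2\<close> in the first one.  There the decay is \<open>exp (-g T\<^sup>1\<^sup>/\<^sup>8)\<close>, and in the second one the exponent of
\<open>T\<close> is \<open>1 / (2 \<mu> l)\<close>.  The exponent \<open>\<zeta> = 1 / (16 \<mu> l)\<close> is strictly below both, so that constants and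
the factor \<open>T\<close> are absorbed.\<close>
lemma coefficient_times_character_le:
  fixes C \<gamma> :: real and l \<mu> :: nat
  assumes "1 \<le> l" "1 \<le> \<mu>" "0 < \<gamma>" "0 < C"
  shows "\<forall>\<^sub>F T in at_top. \<forall>x.
     exp (- (exp (x / real l) / 2)) * min 1 (C * T * exp (- ((T * (\<gamma> * exp (- (real \<mu> * x)))) powr (1/4))))
       \<le> exp (- (T powr (1 / (16 * real \<mu> * real l))))"
proof -
  define \<zeta> where "\<zeta> = 1 / (16 * real \<mu> * real l)"
  define g where "g = \<gamma> powr (1/4)"
  have \<mu>l: "1 \<le> real \<mu> * real l" using assms mult_mono[of 1 "real \<mu>" 1 "real l"] by simp
  have \<zeta>: "0 < \<zeta>" "\<zeta> \<le> 1 / 16" using assms \<mu>l by (auto simp: \<zeta>_def field_simps)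
  have "0 < g" using assms by (simp add: g_def)
  \<comment> \<open>\<open>1\<close> serves the first regime, since \<open>\<zeta> \<le> 1/16\<close>; \<open>2\<close> absorbs the factor \<open>1/2\<close> in the second.\<close>
  have 1: "\<forall>\<^sub>F T in at_top. C * T * exp (- (g * T powr (1/8))) \<le> exp (- (T powr (1/16)))"
    using assms \<open>0 < g\<close> by real_asymp
  have 2: "\<forall>\<^sub>F T in at_top. 2 \<le> T powr \<zeta>"
    using \<zeta> by real_asymp
  from 1 2 eventually_ge_at_top[of 1] show ?thesis
  proof eventually_elim
    case (elim T)
    show ?case
    proof
      fix x
      let ?m = "C * T * exp (- ((T * (\<gamma> * exp (- (real \<mu> * x)))) powr (1/4)))"
      have "exp (- (exp (x / real l) / 2)) * min 1 ?m \<le> exp (- (T powr \<zeta>))"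
      proof (cases "exp (real \<mu> * x) \<le> T powr (1/2)")
        case True
        have "T powr (1/2) = T * T powr (- (1/2))"
        proof -
          have "T * T powr (- (1/2)) = T powr 1 * T powr (- (1/2))" using elim by simp
          also have "\<dots> = T powr (1/2)" unfolding powr_add [symmetric] by simp
          finally show ?thesis by simp
        qed
        also have "\<dots> \<le> T * exp (- (real \<mu> * x))"
          using True elim by (auto simp: exp_minus powr_minus intro!: mult_left_mono le_imp_inverse_le)
        finally have "\<gamma> * T powr (1/2) \<le> T * (\<gamma> * exp (- (real \<mu> * x)))"
          using assms by (simp add: mult_ac)
        then have "(\<gamma> * T powr (1/2)) powr (1/4) \<le> (T * (\<gamma> * exp (- (real \<mu> * x)))) powr (1/4)"
          using assms by (intro powr_mono2) auto
        then have "g * T powr (1/8) \<le> (T * (\<gamma> * exp (- (real \<mu> * x)))) powr (1/4)"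
          using assms by (simp add: powr_mult powr_powr g_def)
        then have "?m \<le> C * T * exp (- (g * T powr (1/8)))"
          using elim assms by (intro mult_left_mono) auto
        also have "\<dots> \<le> exp (- (T powr (1/16)))" by (rule elim)
        also have "\<dots> \<le> exp (- (T powr \<zeta>))" using \<zeta> elim by (simp add: powr_mono)
        finally have "1 * ?m \<le> exp (- (T powr \<zeta>))" by simp
        moreover have "exp (- (exp (x / real l) / 2)) * min 1 ?m \<le> 1 * ?m"
          using elim assms by (intro mult_mono) auto
        ultimately show ?thesis by linarith
      next
        case False
        have "2 * T powr \<zeta> \<le> T powr \<zeta> * T powr \<zeta>" using elim by (intro mult_right_mono) auto
        also have "\<dots> = T powr (2 * \<zeta>)" by (simp flip: powr_add)
        also have "\<dots> \<le> T powr ((1/2) * (1 / (real \<mu> * real l)))"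
          using elim assms \<mu>l by (intro powr_mono) (auto simp: \<zeta>_def field_simps)
        also have "\<dots> = (T powr (1/2)) powr (1 / (real \<mu> * real l))" by (simp add: powr_powr)
        also have "\<dots> \<le> exp (real \<mu> * x) powr (1 / (real \<mu> * real l))"
          using False by (intro powr_mono2) auto
        also have "\<dots> = exp (x / real l)"
          using assms by (simp add: powr_def)
        finally have "exp (- (exp (x / real l) / 2)) \<le> exp (- (T powr \<zeta>))" by simp
        moreover have "exp (- (exp (x / real l) / 2)) * min 1 ?m \<le> exp (- (exp (x / real l) / 2)) * 1"
          by (intro mult_left_mono) auto
        ultimately show ?thesis by linarith
      qed
      then show "exp (- (exp (x / real l) / 2)) * min 1 ?m \<le> exp (- (T powr (1 / (16 * real \<mu> * real l))))"
        by (simp add: \<zeta>_def)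
    qed
  qed
qed

lemma cis_sum: "cis (\<Sum>i\<in>I. x i) = (\<Prod>i\<in>I. cis (x i))"
  by (induction I rule: infinite_finite_induct) (auto simp: cis_mult [symmetric])

lemma fourier_series_along_orbit:
  assumes "F \<in> fourier_class \<eta> \<Delta>"
  shows "((\<lambda>k. cis (2 * pi * (int_dot k \<theta> + s * int_dot k \<rho>)) *\<^sub>C fourier_coeff F k)
     has_sum F (rotation \<rho> s \<theta>)) (int_vectors \<eta>)"
proof -
  have "rotation \<rho> s \<theta> \<in> torus" by (simp add: torus_def rotation_def frac_lt_1)
  then have "((\<lambda>k. cis (2 * pi * int_dot k (rotation \<rho> s \<theta>)) *\<^sub>C fourier_coeff F k)
     has_sum F (rotation \<rho> s \<theta>)) (int_vectors \<eta>)"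
    using assms by (auto simp: fourier_class_def)
  also have "?this \<longleftrightarrow> ?thesis"
    by (rule has_sum_cong) (simp add: cis_int_dot_rotation)
  finally show ?thesis .
qed

lemma fourier_coeff_zero: "fourier_coeff F (\<lambda>_. 0) = bochner torus_measure F"
  by (simp add: fourier_coeff_def)

text \<open>The class constrains the nonzero vectors only; a single further coefficient costs a larger constant.\<close>
lemma norm_fourier_coeff_le:
  assumes "F \<in> fourier_class \<eta> (\<lambda>x. exp (exp x))"
  obtains C where "0 \<le> C"
    "\<And>k. k \<in> int_vectors \<eta> \<Longrightarrow> norm (fourier_coeff F k) \<le> C * exp (- exp (int_norm \<eta> k))"
proof -
  let ?b = "\<lambda>k. exp (exp (int_norm \<eta> k)) * norm (fourier_coeff F k)"
  from assms obtain B where B: "\<And>k. k \<in> int_vectors \<eta> - {\<lambda>_. 0} \<Longrightarrow> ?b k \<le> B"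
    by (auto simp: fourier_class_def bdd_above_def)
  show ?thesis
  proof (rule that[of "max 0 (max B (?b (\<lambda>_. 0)))"])
    fix k assume "k \<in> int_vectors \<eta>"
    then have "?b k \<le> max 0 (max B (?b (\<lambda>_. 0)))"
      using B[of k] by (cases "k = (\<lambda>_. 0)") auto
    then show "norm (fourier_coeff F k) \<le> max 0 (max B (?b (\<lambda>_. 0))) * exp (- exp (int_norm \<eta> k))"
      by (simp add: exp_minus field_simps)
  qed simp
qed

lemma two_mult_le_exp: "2 * x \<le> exp (x :: real)"
proof (cases "0 \<le> x")
  case True
  have "2 * x \<le> (1 + x / 2)\<^sup>2"
    using zero_le_power2[of "1 - x / 2"] by (simp add: power2_eq_square algebra_simps)
  also have "\<dots> \<le> exp (x / 2) ^ 2" using True by (intro power_mono exp_ge_add_one_self) auto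
  also have "\<dots> = exp x" by (simp flip: exp_of_nat_mult)
  finally show ?thesis .
next
  case False
  then show ?thesis using exp_gt_zero[of x] by linarith
qed

text \<open>The exponent \<open>\<Sum>\<^sub>i exp (x\<^sub>i)\<close> is used twice.  One half dominates \<open>\<Sum>\<^sub>i x\<^sub>i\<close> and provides summability.  The
other half is at least \<open>exp (a) / 2\<close> for the mean \<open>a\<close> of the \<open>x\<^sub>i\<close>, since some \<open>x\<^sub>i\<close> is not below the mean.\<close>
lemma prod_double_exp_le:
  assumes "1 \<le> l"
  shows "(\<Prod>i=1..l. exp (- exp (x i))) \<le> (\<Prod>i=1..l. exp (- x i)) * exp (- (exp ((\<Sum>i=1..l. x i) / real l) / 2))"
proof -
  define a where "a = (\<Sum>i=1..l. x i) / real l"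
  have "\<exists>i\<in>{1..l}. a \<le> x i"
  proof (rule ccontr)
    assume "\<not> ?thesis"
    then have "(\<Sum>i=1..l. x i) < (\<Sum>i=1..l. a)"
      using assms by (intro sum_strict_mono) (auto simp: not_le)
    then show False using assms by (simp add: a_def)
  qed
  then obtain i where i: "i \<in> {1..l}" "a \<le> x i" by blast
  have "exp a \<le> exp (x i)" using i by simp
  also have "\<dots> \<le> (\<Sum>i=1..l. exp (x i))" using i by (intro member_le_sum) auto
  finally have 1: "exp a \<le> (\<Sum>i=1..l. exp (x i))" .
  have "2 * (\<Sum>i=1..l. x i) \<le> (\<Sum>i=1..l. exp (x i))"
    unfolding sum_distrib_left by (intro sum_mono two_mult_le_exp)
  with 1 have "- (\<Sum>i=1..l. exp (x i)) \<le> - (\<Sum>i=1..l. x i) - exp a / 2" by linarith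
  then have "exp (- (\<Sum>i=1..l. exp (x i))) \<le> exp (- (\<Sum>i=1..l. x i)) * exp (- (exp a / 2))"
    by (simp flip: exp_add)
  then show ?thesis by (simp add: a_def exp_sum flip: sum_negf)
qed

section \<open>Convergence of the weighted multiple averages\<close>

theorem theorem4p4:
  fixes l \<mu> \<eta> :: nat
    and \<rho> :: "nat \<Rightarrow> nat \<Rightarrow> real"
    and F :: "nat \<Rightarrow> (nat \<Rightarrow> real) \<Rightarrow> 'b::complex_banach_algebra"
  assumes "1 \<le> l"
    and "2 \<le> \<mu>" and "\<mu> = \<eta>"
    and "\<forall>i\<in>{1..l}. \<rho> i \<in> UNIV \<rightarrow> {1..2}"
    and "\<forall>i\<in>{1..l}. F i \<in> fourier_class \<eta> (\<lambda>x. exp (exp x))"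
  shows "\<exists>\<zeta>>0.
     (joint_diophantine_discrete l \<eta> \<mu> \<rho> \<longrightarrow>
        (\<exists>C. \<forall>\<^sub>F N in sequentially. \<forall>\<theta>\<in>torus.
           norm (DMW l \<rho> F N \<theta> - ordered_prod l (\<lambda>i. bochner torus_measure (F i)))
             \<le> C * exp (- (real N powr \<zeta>)))) \<and>
     (joint_diophantine_continuous l \<eta> \<mu> \<rho> \<longrightarrow>
        (\<exists>C. \<forall>\<^sub>F T in at_top. \<forall>\<theta>\<in>torus.
           norm (CMW l \<rho> F T \<theta> - ordered_prod l (\<lambda>i. bochner torus_measure (F i)))
             \<le> C * exp (- (T powr \<zeta>))))"
proof -
  define J where "J = PiE {1..l} (\<lambda>_. int_vectors \<eta>)"
  define c where "c = (\<lambda>\<kappa>. ordered_prod l (\<lambda>i. fourier_coeff (F i) (\<kappa> i)))"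
  define m where "m = (\<lambda>\<kappa>. \<Sum>i=1..l. int_norm \<eta> (\<kappa> i))"
  define M where "M = (\<lambda>\<kappa>. \<Prod>i=1..l. exp (- int_norm \<eta> (\<kappa> i)))"
  \<comment> \<open>The resonant index; outside \<open>{1..l}\<close> it has to be \<open>undefined\<close> to lie in \<open>J\<close>.\<close>
  define \<kappa>0 :: "nat \<Rightarrow> nat \<Rightarrow> int" where "\<kappa>0 = (\<lambda>i\<in>{1..l}. \<lambda>_. 0)"
  define \<zeta> where "\<zeta> = 1 / (16 * real \<mu> * real l)"
  let ?E = "\<lambda>\<theta> \<kappa> s. cis (2 * pi * (\<Sum>i=1..l. int_dot (\<kappa> i) \<theta>)) * cis (2 * pi * (s * joint_dot l \<kappa> \<rho>))"
  let ?G = "\<lambda>\<theta> s. ordered_prod l (\<lambda>i. F i (rotation (\<rho> i) s \<theta>))"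

  have \<mu>: "1 \<le> \<mu>" "1 \<le> \<eta>" using assms by auto
  have F: "F i \<in> fourier_class \<eta> (\<lambda>x. exp (exp x))" if "i \<in> {1..l}" for i
    using assms(5) that by blast
  have "0 < \<zeta>" using assms by (simp add: \<zeta>_def)
  have "\<exists>C. 0 \<le> C \<and> (\<forall>k\<in>int_vectors \<eta>. norm (fourier_coeff (F i) k) \<le> C * exp (- exp (int_norm \<eta> k)))"
    if "i \<in> {1..l}" for i
    using norm_fourier_coeff_le[OF F[OF that]] by metis
  then obtain B where B: "\<And>i. i \<in> {1..l} \<Longrightarrow> 0 \<le> B i"
    "\<And>i k. i \<in> {1..l} \<Longrightarrow> k \<in> int_vectors \<eta> \<Longrightarrow> norm (fourier_coeff (F i) k) \<le> B i * exp (- exp (int_norm \<eta> k))"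
    by metis
  have M_nonneg: "0 \<le> M \<kappa>" for \<kappa> by (simp add: M_def prod_nonneg)
  have M_summable: "M summable_on J"
    unfolding M_def J_def by (intro summable_on_prod_PiE exp_int_norm_summable \<mu>) auto
  have coeff_summable: "(\<lambda>k. norm (fourier_coeff (F i) k)) summable_on int_vectors \<eta>" if "i \<in> {1..l}" for i
  proof (rule Infinite_Sum.abs_summable_on_comparison_test')
    show "(\<lambda>k. B i * exp (- int_norm \<eta> k)) summable_on int_vectors \<eta>"
      by (intro summable_on_cmult_right exp_int_norm_summable \<mu>)
    fix k assume "k \<in> int_vectors \<eta>"
    then have "norm (fourier_coeff (F i) k) \<le> B i * exp (- exp (int_norm \<eta> k))" using B that by blast
    also have "\<dots> \<le> B i * exp (- int_norm \<eta> k)"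
    proof (rule mult_left_mono)
      show "exp (- exp (int_norm \<eta> k)) \<le> exp (- int_norm \<eta> k)"
        unfolding exp_le_cancel_iff using exp_ge_add_one_self[of "int_norm \<eta> k"] by linarith
    qed (use B that in auto)
    finally show "norm (fourier_coeff (F i) k) \<le> B i * exp (- int_norm \<eta> k)" .
  qed
  have c_summable: "(\<lambda>\<kappa>. norm (c \<kappa>)) summable_on J"
    unfolding c_def J_def by (intro ordered_prod_summable coeff_summable assms)
  have series: "((\<lambda>\<kappa>. ?E \<theta> \<kappa> s *\<^sub>C c \<kappa>) has_sum ?G \<theta> s) J" for \<theta> s
  proof -
    have "((\<lambda>\<kappa>. ordered_prod l (\<lambda>i. cis (2 * pi * (int_dot (\<kappa> i) \<theta> + s * int_dot (\<kappa> i) (\<rho> i))) *\<^sub>C fourier_coeff (F i) (\<kappa> i)))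
        has_sum ?G \<theta> s) J"
      unfolding J_def
    proof (rule ordered_prod_has_sum[where f = "\<lambda>i k. cis (2 * pi * (int_dot k \<theta> + s * int_dot k (\<rho> i))) *\<^sub>C fourier_coeff (F i) k", OF assms(1)])
      fix i assume i: "i \<in> {1..l}"
      show "((\<lambda>k. cis (2 * pi * (int_dot k \<theta> + s * int_dot k (\<rho> i))) *\<^sub>C fourier_coeff (F i) k)
          has_sum F i (rotation (\<rho> i) s \<theta>)) (int_vectors \<eta>)"
        by (rule fourier_series_along_orbit[OF F[OF i]])
      show "(\<lambda>k. norm (cis (2 * pi * (int_dot k \<theta> + s * int_dot k (\<rho> i))) *\<^sub>C fourier_coeff (F i) k)) summable_on int_vectors \<eta>"
        using coeff_summable[OF i] by (simp add: norm_scaleC)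
    qed
    then show ?thesis
      unfolding ordered_prod_scaleC[OF assms(1)]
      by (simp add: c_def joint_dot_def distrib_left cis_mult[symmetric]
          prod.distrib cis_sum sum_distrib_left)
  qed
  obtain K where K: "\<And>x y :: 'b. norm (x * y) \<le> norm x * norm y * K" "0 \<le> K"
    using bounded_bilinear.nonneg_bounded[OF bounded_bilinear_algebra_mult] by auto
  define D where "D = K ^ (l - 1) * (\<Prod>i=1..l. B i)"
  have "0 \<le> D" using K B by (auto simp: D_def intro!: mult_nonneg_nonneg prod_nonneg)
  have c_le: "norm (c \<kappa>) \<le> D * M \<kappa> * exp (- (exp (m \<kappa> / real l) / 2))" if "\<kappa> \<in> J" for \<kappa>
  proof -
    have "norm (c \<kappa>) \<le> K ^ (l - 1) * (\<Prod>i=1..l. norm (fourier_coeff (F i) (\<kappa> i)))"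
      unfolding c_def by (rule norm_ordered_prod_le[OF K assms(1)])
    also have "\<dots> \<le> K ^ (l - 1) * (\<Prod>i=1..l. B i * exp (- exp (int_norm \<eta> (\<kappa> i))))"
      using that K by (intro mult_left_mono prod_mono) (auto simp: J_def intro!: B)
    also have "\<dots> = D * (\<Prod>i=1..l. exp (- exp (int_norm \<eta> (\<kappa> i))))"
      by (simp add: D_def prod.distrib)
    also have "\<dots> \<le> D * (M \<kappa> * exp (- (exp (m \<kappa> / real l) / 2)))"
      unfolding M_def m_def using \<open>0 \<le> D\<close> by (intro mult_left_mono prod_double_exp_le assms)
    finally show ?thesis by (simp add: mult.assoc)
  qed
  have \<kappa>0: "\<kappa>0 \<in> J" by (auto simp: \<kappa>0_def J_def)
  have E_\<kappa>0: "?E \<theta> \<kappa>0 s = 1" for \<theta> s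
    by (simp add: \<kappa>0_def joint_dot_def)
  have c_\<kappa>0: "c \<kappa>0 = ordered_prod l (\<lambda>i. bochner torus_measure (F i))"
    unfolding c_def using assms(1) by (intro ordered_prod_cong) (auto simp: \<kappa>0_def fourier_coeff_zero)
  have nonzero: "joint_nonzero l \<eta> \<kappa>" if "\<kappa> \<in> J" "\<kappa> \<noteq> \<kappa>0" for \<kappa>
  proof -
    have "\<exists>i\<in>{1..l}. \<kappa> i \<noteq> (\<lambda>_. 0)"
    proof (rule ccontr)
      assume "\<not> ?thesis"
      then have "\<kappa> = \<kappa>0"
        using that(1) \<kappa>0 unfolding J_def by (intro PiE_ext[of \<kappa>]) (auto simp: \<kappa>0_def)
      with that show False by simp
    qed
    with that show ?thesis by (auto simp: joint_nonzero_def J_def)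
  qed
  have dioph: "\<gamma> * exp (- (real \<mu> * m \<kappa>)) \<le> \<gamma> * dioph_weight l \<mu> \<kappa>" if "\<kappa> \<in> J" "0 < \<gamma>" for \<kappa> \<gamma>
  proof (rule mult_left_mono)
    have "\<kappa> i \<in> int_vectors \<eta>" if "i \<in> {1..l}" for i
      using \<open>\<kappa> \<in> J\<close> that by (auto simp: J_def)
    then show "exp (- (real \<mu> * m \<kappa>)) \<le> dioph_weight l \<mu> \<kappa>"
      unfolding m_def assms(3) by (rule exp_le_dioph_weight[OF \<mu>(2)])
  qed (use that in simp)

  \<comment> \<open>Common to both averages: \<open>a \<kappa>\<close> stands for the mean of the character with index \<open>\<kappa>\<close>.\<close>
  have error: "norm (G - c \<kappa>0) \<le> D * infsum M J * exp (- (T powr \<zeta>))"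
    if tr: "\<forall>x. exp (- (exp (x / real l) / 2)) * min 1 (C * T * exp (- ((T * (\<gamma> * exp (- (real \<mu> * x)))) powr (1/4))))
         \<le> exp (- (T powr \<zeta>))"
      and G: "((\<lambda>\<kappa>. a \<kappa> *\<^sub>C c \<kappa>) has_sum G) J" and "a \<kappa>0 = 1"
      and a: "\<And>\<kappa>. \<kappa> \<in> J \<Longrightarrow> \<kappa> \<noteq> \<kappa>0 \<Longrightarrow>
         cmod (a \<kappa>) \<le> min 1 (C * T * exp (- ((T * (\<gamma> * exp (- (real \<mu> * m \<kappa>)))) powr (1/4))))"
    for G a C T \<gamma>
  proof -
    have "norm (G - c \<kappa>0) \<le> (D * exp (- (T powr \<zeta>))) * infsum M J"
    proof (rule norm_has_sum_diff_le[OF G \<kappa>0 \<open>a \<kappa>0 = 1\<close> _ M_summable M_nonneg])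
      fix \<kappa> assume \<kappa>: "\<kappa> \<in> J" "\<kappa> \<noteq> \<kappa>0"
      let ?min = "min 1 (C * T * exp (- ((T * (\<gamma> * exp (- (real \<mu> * m \<kappa>)))) powr (1/4))))"
      have "norm (a \<kappa> *\<^sub>C c \<kappa>) \<le> ?min * (D * M \<kappa> * exp (- (exp (m \<kappa> / real l) / 2)))"
        unfolding norm_scaleC using a[OF \<kappa>] c_le[OF \<kappa>(1)]
        by (intro mult_mono norm_ge_zero order_trans[OF norm_ge_zero a[OF \<kappa>]]) auto
      also have "\<dots> = D * M \<kappa> * (exp (- (exp (m \<kappa> / real l) / 2)) * ?min)" by (simp add: mult_ac)
      also have "\<dots> \<le> D * M \<kappa> * exp (- (T powr \<zeta>))"
        using tr \<open>0 \<le> D\<close> M_nonneg by (intro mult_left_mono) auto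
      finally show "norm (a \<kappa> *\<^sub>C c \<kappa>) \<le> D * exp (- (T powr \<zeta>)) * M \<kappa>" by (simp add: mult_ac)
    qed (use \<open>0 \<le> D\<close> in auto)
    then show ?thesis by (simp add: mult_ac)
  qed

  have discrete: "\<exists>C. \<forall>\<^sub>F N in sequentially. \<forall>\<theta>\<in>torus.
       norm (DMW l \<rho> F N \<theta> - c \<kappa>0) \<le> C * exp (- (real N powr \<zeta>))"
    if "joint_diophantine_discrete l \<eta> \<mu> \<rho>"
  proof -
    from that obtain \<gamma> where \<gamma>: "0 < \<gamma>" "\<And>\<kappa> n. joint_nonzero l \<eta> \<kappa> \<Longrightarrow>
        \<bar>joint_dot l \<kappa> \<rho> - of_int n\<bar> > \<gamma> * dioph_weight l \<mu> \<kappa>"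
      unfolding joint_diophantine_discrete_def by blast
    obtain C where C: "0 < C" "\<And>N \<delta> \<alpha>. 2 \<le> N \<Longrightarrow> 0 < \<delta> \<Longrightarrow> (\<And>n::int. \<delta> \<le> \<bar>\<alpha> - of_int n\<bar>) \<Longrightarrow>
       cmod (discrete_mean N (\<lambda>s. cis (2 * pi * (s * \<alpha>)))) \<le> C * real N * exp (- ((real N * \<delta>) powr (1/4)))"
      by (rule discrete_mean_character_le) blast
    have "\<forall>\<^sub>F N in sequentially. \<forall>x. exp (- (exp (x / real l) / 2)) *
        min 1 (C * real N * exp (- ((real N * (\<gamma> * exp (- (real \<mu> * x)))) powr (1/4)))) \<le> exp (- (real N powr \<zeta>))"
      unfolding \<zeta>_def
      by (rule eventually_compose_filterlim[OF coefficient_times_character_le[OF assms(1) \<mu>(1) \<gamma>(1) C(1)] filterlim_real_sequentially])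
    from this eventually_ge_at_top[of 2]
    have "\<forall>\<^sub>F N in sequentially. \<forall>\<theta>\<in>torus.
       norm (DMW l \<rho> F N \<theta> - c \<kappa>0) \<le> D * infsum M J * exp (- (real N powr \<zeta>))"
    proof eventually_elim
      case (elim N)
      show ?case
      proof
        fix \<theta>
        show "norm (DMW l \<rho> F N \<theta> - c \<kappa>0) \<le> D * infsum M J * exp (- (real N powr \<zeta>))"
        proof (rule error[OF elim(1)])
          show "((\<lambda>\<kappa>. discrete_mean N (?E \<theta> \<kappa>) *\<^sub>C c \<kappa>) has_sum DMW l \<rho> F N \<theta>) J"
            using discrete_mean_has_sum[OF series[of \<theta>], of N] by (simp add: DMW_def discrete_mean_def)
          show "discrete_mean N (?E \<theta> \<kappa>0) = 1"
            unfolding E_\<kappa>0 using elim(2) by (rule discrete_mean_one)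
          fix \<kappa> assume \<kappa>: "\<kappa> \<in> J" "\<kappa> \<noteq> \<kappa>0"
          let ?\<delta> = "\<gamma> * exp (- (real \<mu> * m \<kappa>))"
          have "?\<delta> \<le> \<bar>joint_dot l \<kappa> \<rho> - of_int n\<bar>" for n
            using dioph[OF \<kappa>(1) \<gamma>(1)] \<gamma>(2)[OF nonzero[OF \<kappa>], of n] by linarith
          then have "cmod (discrete_mean N (?E \<theta> \<kappa>)) \<le> C * real N * exp (- ((real N * ?\<delta>) powr (1/4)))"
            unfolding discrete_mean_mult norm_mult norm_cis mult_1
            using elim(2) \<gamma>(1) by (intro C(2)) auto
          moreover have "cmod (discrete_mean N (?E \<theta> \<kappa>)) \<le> 1"
            using elim(2) by (rule cmod_discrete_mean_le_1) (simp add: norm_mult)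
          ultimately show "cmod (discrete_mean N (?E \<theta> \<kappa>))
              \<le> min 1 (C * real N * exp (- ((real N * ?\<delta>) powr (1/4))))"
            by simp
        qed
      qed
    qed
    then show ?thesis by blast
  qed

  have continuous: "\<exists>C. \<forall>\<^sub>F T in at_top. \<forall>\<theta>\<in>torus.
       norm (CMW l \<rho> F T \<theta> - c \<kappa>0) \<le> C * exp (- (T powr \<zeta>))"
    if "joint_diophantine_continuous l \<eta> \<mu> \<rho>"
  proof -
    from that obtain \<gamma> where \<gamma>: "0 < \<gamma>" "\<And>\<kappa>. joint_nonzero l \<eta> \<kappa> \<Longrightarrow>
        \<bar>joint_dot l \<kappa> \<rho>\<bar> > \<gamma> * dioph_weight l \<mu> \<kappa>"
      unfolding joint_diophantine_continuous_def by blast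
    obtain C where C: "0 < C" "\<And>T \<delta> \<alpha>. 0 < T \<Longrightarrow> 0 < \<delta> \<Longrightarrow> \<delta> \<le> \<bar>\<alpha>\<bar> \<Longrightarrow>
       cmod (continuous_mean T (\<lambda>s. cis (2 * pi * (s * \<alpha>)))) \<le> C * exp (- ((T * \<delta>) powr (1/4)))"
      by (rule continuous_mean_character_le) blast
    from coefficient_times_character_le[OF assms(1) \<mu>(1) \<gamma>(1) C(1)] eventually_ge_at_top[of 1]
    have "\<forall>\<^sub>F T in at_top. \<forall>\<theta>\<in>torus.
       norm (CMW l \<rho> F T \<theta> - c \<kappa>0) \<le> D * infsum M J * exp (- (T powr \<zeta>))"
    proof eventually_elim
      case (elim T)
      have T: "0 < T" using elim(2) by simp
      have cont: "continuous_on UNIV (?E \<theta> \<kappa>)" for \<theta> \<kappa>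
        by (intro continuous_intros)
      show ?case
      proof
        fix \<theta>
        show "norm (CMW l \<rho> F T \<theta> - c \<kappa>0) \<le> D * infsum M J * exp (- (T powr \<zeta>))"
        proof (rule error[OF elim(1)[folded \<zeta>_def]])
          have "((\<lambda>\<kappa>. continuous_mean T (?E \<theta> \<kappa>) *\<^sub>C c \<kappa>) has_sum continuous_mean T (?G \<theta>)) J"
            by (rule continuous_mean_has_sum[OF series c_summable _ cont]) (simp add: norm_mult)
          then show "((\<lambda>\<kappa>. continuous_mean T (?E \<theta> \<kappa>) *\<^sub>C c \<kappa>) has_sum CMW l \<rho> F T \<theta>) J"
            by (simp add: CMW_def continuous_mean_def)
          show "continuous_mean T (?E \<theta> \<kappa>0) = 1"
            unfolding E_\<kappa>0 using T by (rule continuous_mean_one)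
          fix \<kappa> assume \<kappa>: "\<kappa> \<in> J" "\<kappa> \<noteq> \<kappa>0"
          let ?\<delta> = "\<gamma> * exp (- (real \<mu> * m \<kappa>))"
          have "?\<delta> \<le> \<bar>joint_dot l \<kappa> \<rho>\<bar>"
            using dioph[OF \<kappa>(1) \<gamma>(1)] \<gamma>(2)[OF nonzero[OF \<kappa>]] by linarith
          then have "cmod (continuous_mean T (?E \<theta> \<kappa>)) \<le> C * exp (- ((T * ?\<delta>) powr (1/4)))"
            unfolding continuous_mean_mult norm_mult norm_cis mult_1
            using T \<gamma>(1) by (intro C(2)) auto
          \<comment> \<open>The spare factor \<open>T \<ge> 1\<close> matches the form that the discrete average requires.\<close>
          also have "\<dots> \<le> C * T * exp (- ((T * ?\<delta>) powr (1/4)))"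
            using elim(2) C(1) by simp
          finally have "cmod (continuous_mean T (?E \<theta> \<kappa>)) \<le> C * T * exp (- ((T * ?\<delta>) powr (1/4)))" .
          moreover have "cmod (continuous_mean T (?E \<theta> \<kappa>)) \<le> 1"
            using T by (rule cmod_continuous_mean_le_1) (simp add: norm_mult, rule cont)
          ultimately show "cmod (continuous_mean T (?E \<theta> \<kappa>))
              \<le> min 1 (C * T * exp (- ((T * ?\<delta>) powr (1/4))))"
            by simp
        qed
      qed
    qed
    then show ?thesis by blast
  qed

  from \<open>0 < \<zeta>\<close> discrete continuous show ?thesis
    unfolding c_\<kappa>0 by blast
qed

end
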